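(* Let $a,s,b$ be distinct vertices of $\vec G(n,p)$, let $A:=\{a\not\to s\}$ and $B:=\{s\not\to b\}$, and let $M\sim \operatorname{Bin}\bigl(\binom n2,p\bigr)$ be the number of edges of $G(n,p)$. For every fixed $p\in(0,1]$, as $n\to\infty$, \[ \mathbb E\bigl(\operatorname{Cov}(A,B\mid M)\bigr)=\Bigl(3-(4-2p)\,e^{2\frac{p(1-p)}{(2-p)^2}}+o(1)\Bigr)\bigl(1-p/2\bigr)^{2n-3}, \] \[ \operatorname{Var}\bigl(\mathbb P(A\mid M)\bigr)=4\Bigl(e^{2\frac{p(1-p)}{(2-p)^2}}-1+o(1)\Bigr)\bigl(1-p/2\bigr)^{2n-2}. \]
   Context: $G(n,p)$ is the random graph on $n$ labelled vertices in which each possible edge is present independently with probability $p$. $\vec G(n,p)$ is obtained by giving each present edge one of its two orientations with probability $1/2$ each, independently of everything else; probabilities are in the combined space of graph and orientations. $\{u\not\to v\}$ is the event that there is no directed path from $u$ to $v$. $\operatorname{Cov}(A,B\mid M):=\mathbb P(A\cap B\mid M)-\mathbb P(A\mid M)\mathbb P(B\mid M)$, computed in $\vec G(n,p)$. *)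

theory Defs
  imports "HOL-Probability.Probability"
begin

section \<open>The random graph and its random orientation\<close>

text \<open>The vertex set is \<open>{..<n}\<close>; an undirected edge is a two-element set of vertices.\<close>

definition vertex_pairs :: "nat \<Rightarrow> nat set set" where
  "vertex_pairs n = {e. e \<subseteq> {..<n} \<and> card e = 2}"

definition gnp :: "nat \<Rightarrow> real \<Rightarrow> nat set set pmf" where
  "gnp n p = map_pmf (\<lambda>f. {e \<in> vertex_pairs n. f e})
     (Pi_pmf (vertex_pairs n) False (\<lambda>_. bernoulli_pmf p))"

text \<open>For an edge \<open>e = {x, y}\<close> the set \<open>{(u, v). {u, v} = e}\<close> consists of the two arcs
  \<open>(x, y)\<close> and \<open>(y, x)\<close>.\<close>

definition random_orientation :: "nat set set \<Rightarrow> (nat \<times> nat) set pmf" where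
  "random_orientation E = map_pmf (\<lambda>f. f ` E)
     (Pi_pmf E undefined (\<lambda>e. pmf_of_set {(u, v). {u, v} = e}))"

text \<open>An outcome of the combined space is a pair of an undirected edge set and the set of arcs
  obtained by orienting each of its edges.\<close>

definition oriented_gnp :: "nat \<Rightarrow> real \<Rightarrow> (nat set set \<times> (nat \<times> nat) set) pmf" where
  "oriented_gnp n p =
     bind_pmf (gnp n p) (\<lambda>E. map_pmf (\<lambda>D. (E, D)) (random_orientation E))"

definition no_path :: "nat \<Rightarrow> nat \<Rightarrow> (nat set set \<times> (nat \<times> nat) set) set" where
  "no_path u v = {\<omega>. (u, v) \<notin> (snd \<omega>)\<^sup>*}"

definition num_edges :: "nat set set \<times> (nat \<times> nat) set \<Rightarrow> nat" where
  "num_edges \<omega> = card (fst \<omega>)"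


section \<open>Conditioning on a discrete random variable\<close>

text \<open>\<open>prob_given P A X\<close> is the random variable \<open>\<P>(A | X)\<close>: at the outcome \<open>\<omega>\<close> it takes the
  elementary conditional probability of \<open>A\<close> given \<open>X = X \<omega>\<close>. The conditioning event has
  positive probability for every \<open>\<omega>\<close> in the support of \<open>P\<close>.\<close>

definition prob_given :: "'a pmf \<Rightarrow> 'a set \<Rightarrow> ('a \<Rightarrow> 'b) \<Rightarrow> 'a \<Rightarrow> real" where
  "prob_given P A X \<omega> = \<P>(\<eta> in measure_pmf P. \<eta> \<in> A \<bar> X \<eta> = X \<omega>)"

definition cov_given :: "'a pmf \<Rightarrow> 'a set \<Rightarrow> 'a set \<Rightarrow> ('a \<Rightarrow> 'b) \<Rightarrow> 'a \<Rightarrow> real" where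
  "cov_given P A B X \<omega> = prob_given P (A \<inter> B) X \<omega> - prob_given P A X \<omega> * prob_given P B X \<omega>"


section \<open>The number of edges is binomially distributed\<close>

lemma finite_vertex_pairs: "finite (vertex_pairs n)"
  unfolding vertex_pairs_def by (rule finite_subset[of _ "Pow {..<n}"]) auto

lemma card_vertex_pairs: "card (vertex_pairs n) = n choose 2"
  unfolding vertex_pairs_def using n_subsets[of "{..<n}" 2] by simp

lemma num_edges_binomial:
  assumes "p \<in> {0..1}"
  shows "map_pmf num_edges (oriented_gnp n p) = binomial_pmf (n choose 2) p"
proof -
  have "map_pmf num_edges (oriented_gnp n p) = map_pmf card (gnp n p)"
    unfolding oriented_gnp_def num_edges_def
    by (simp add: map_bind_pmf map_pmf_comp map_pmf_const) (simp add: map_pmf_def)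
  also have "\<dots> = binomial_pmf (n choose 2) p"
    unfolding gnp_def map_pmf_comp
    by (rule binomial_pmf_altdef'[symmetric])
       (use assms finite_vertex_pairs card_vertex_pairs in auto)
  finally show ?thesis .
qed

end

theory Submission
  imports Defs
begin

text \<open>
  Write \<open>q = 1 - p/2\<close>, \<open>N = n choose 2\<close> and \<open>\<theta> = p (1 - p) / (2 - p)\<^sup>2\<close>. There is no path from \<open>u\<close>
  to \<open>v\<close>, in symbols \<open>\<not> u \<rightarrow> v\<close>, exactly if some vertex set \<open>S\<close> contains \<open>u\<close>, omits
  \<open>v\<close> and has no arc leaving it. For a fixed \<open>S\<close> this forbids one arc on each of \<open>|S| (n - |S|)\<close> pairs and so has probability
  \<open>q ^ (|S| (n - |S|))\<close>. The two sets \<open>{u}\<close> and the complement of \<open>{v}\<close> have \<open>n - 1\<close> such pairs; all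
  others have at least \<open>2 (n - 2)\<close>, and together they are negligible. Everything therefore comes down to
  events that an arc set \<open>F\<close>, with at most one arc on each pair, is avoided.

  \<^bold>\<open>Conditional probabilities.\<close> Given \<open>m\<close> edges, \<open>F\<close> with \<open>|F| = k\<close> is avoided with probability
  \<open>h k m\<close>, the mean of \<open>(1/2) ^ H\<close> for a hypergeometric variable \<open>H\<close>, the number of chosen edges among
  \<open>k\<close> given pairs. Such a mean may be computed with either of the two sets held fixed and the other one
  random. Hence \<open>h j |E|\<close> is the average of \<open>(1/2) ^ |E \<inter> J|\<close> over all sets \<open>J\<close> of \<open>j\<close> pairs, and
  \<open>\<E>(h k M * h j M)\<close> is, for a fixed \<open>K\<close> of size \<open>k\<close>, the average over \<open>J\<close> of
  \<open>\<E>((1/2) ^ (|E \<inter> K| + |E \<inter> J|))\<close>. The edges being independent, this expectation is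
  \<open>q ^ (k + j) (1 + \<theta>) ^ |J \<inter> K|\<close>, and the average over \<open>J\<close> is once more hypergeometric
  (\<open>expectation_prob_given_avoid_mult\<close>),
  \<open>\<E>(h k M * h j M) = q ^ (k + j) * (\<Sum>r. (k choose r) * (j choose r) / (N choose r) * \<theta> ^ r)\<close>.
  For \<open>k = j = n - 1\<close> the \<open>r\<close>-th summand tends to \<open>(2 \<theta>) ^ r / r!\<close>, which produces the factor
  \<open>exp (2 \<theta>)\<close>; in general the sum is at most \<open>exp (\<theta> k j / N) \<le> exp (\<theta> (k + j) / 2)\<close>.

  \<^bold>\<open>The variance and the product.\<close> By the description through cuts the variables \<open>\<P>(\<not> u \<rightarrow> v | M)\<close> and
  \<open>\<P>(\<not> w \<rightarrow> z | M)\<close> are both \<open>2 * h (n - 1) M\<close> up to a sum of terms \<open>h j M\<close> with \<open>j \<ge> 2 (n - 2)\<close>, and the mean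
  of their product is \<open>4 * \<E>((h (n - 1) M)\<^sup>2)\<close> up to a polynomial times \<open>\<rho> ^ (3 n)\<close>, where
  \<open>\<rho> = q exp (\<theta> / 2)\<close>. Since \<open>\<rho> ^ 3 < q ^ 2\<close>, the error is \<open>o(q ^ (2 n))\<close>
  (\<open>product_moment_no_path_approx\<close>). With \<open>u = w\<close> and \<open>v = z\<close> this is
  the second moment in the variance, whose square of the mean is \<open>4 * q ^ (2 n - 2)\<close> up to
  \<open>o(q ^ (2 n))\<close>; otherwise it is the product in the covariance.

  \<^bold>\<open>The joint probability.\<close> For \<open>\<not> a \<rightarrow> s\<close> and \<open>\<not> s \<rightarrow> b\<close> three configurations have probability
  \<open>q ^ (2 n - 3)\<close> each: \<open>{a}\<close> and \<open>{a, s}\<close> have no outgoing arcs; \<open>{b}\<close> and \<open>{s, b}\<close> have no incoming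
  arcs; or \<open>{a}\<close> has no outgoing and \<open>{b}\<close> no incoming arcs. Everything else, including the overlaps of
  the three, has probability at most a polynomial times \<open>q ^ (3 n)\<close> or \<open>(1 - p) ^ n\<close>, and
  \<open>1 - p < q ^ 2\<close> (\<open>two_cuts_cases\<close>, \<open>prob_no_path_both_le\<close>, \<open>prob_no_path_both_ge\<close>). This is the
  \<open>3\<close> in the covariance.
\<close>

section \<open>The hypergeometric generating function\<close>

text \<open>The mean of \<open>(1 + z) ^ H\<close>, where \<open>H\<close> is hypergeometric: the size of the intersection of a fixed
  \<open>k\<close>-subset with a uniformly random \<open>m\<close>-subset of an \<open>N\<close>-set. The expansion in binomial moments is
  chosen because it is symmetric in \<open>k\<close> and \<open>m\<close> at sight.\<close>

definition hypergeom_gf :: "nat \<Rightarrow> nat \<Rightarrow> nat \<Rightarrow> real \<Rightarrow> real" where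
  "hypergeom_gf N k m z =
     (\<Sum>r\<le>k. real (k choose r) * real (m choose r) / real (N choose r) * z ^ r)"

lemma hypergeom_gf_commute: "hypergeom_gf N k m z = hypergeom_gf N m k z"
proof -
  have "hypergeom_gf N k m z =
      (\<Sum>r\<le>max k m. real (k choose r) * real (m choose r) / real (N choose r) * z ^ r)" for k m
    unfolding hypergeom_gf_def by (rule sum.mono_neutral_left) (auto simp: binomial_eq_0)
  from this[of k m] this[of m k] show ?thesis
    by (simp add: max.commute mult.commute)
qed

lemma card_supersets:
  assumes "finite V" "T \<subseteq> V" "m \<le> card V"
  shows "real (card {E. E \<subseteq> V \<and> card E = m \<and> T \<subseteq> E}) =
    real (card V choose m) * (real (m choose card T) / real (card V choose card T))"
proof (cases "card T \<le> m")
  case True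
  have fT: "finite T" using assms finite_subset by blast
  have "bij_betw (\<lambda>E. E - T) {E. E \<subseteq> V \<and> card E = m \<and> T \<subseteq> E}
      {F. F \<subseteq> V - T \<and> card F = m - card T}"
    by (rule bij_betwI[where g = "\<lambda>F. F \<union> T"])
       (use True assms fT in \<open>auto simp: card_Diff_subset card_Un_disjoint finite_subset
          intro!: card_Un_disjoint[THEN trans]\<close>)
  then have "card {E. E \<subseteq> V \<and> card E = m \<and> T \<subseteq> E} = (card V - card T) choose (m - card T)"
    using assms fT by (simp add: bij_betw_same_card n_subsets card_Diff_subset)
  moreover have "(card V choose m) * (m choose card T) =
      (card V choose card T) * ((card V - card T) choose (m - card T))"
    using True assms by (intro choose_mult) auto
  moreover have "card V choose card T \<noteq> 0"
    using card_mono[OF assms(1,2)] by simp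
  ultimately show ?thesis
    by (simp add: field_simps flip: of_nat_mult)
next
  case False
  then have "{E. E \<subseteq> V \<and> card E = m \<and> T \<subseteq> E} = {}"
    using assms by (auto dest: card_mono[rotated] finite_subset)
  then show ?thesis using False by (simp only:) (simp add: binomial_eq_0)
qed

lemma sum_Pow_by_card:
  fixes g :: "nat \<Rightarrow> real"
  assumes "finite K"
  shows "(\<Sum>T\<in>Pow K. g (card T)) = (\<Sum>r\<le>card K. real (card K choose r) * g r)"
proof -
  have "(\<Sum>T\<in>Pow K. g (card T)) = (\<Sum>r\<le>card K. \<Sum>T\<in>{T \<in> Pow K. card T = r}. g (card T))"
    using assms by (intro sum.group[symmetric]) (auto intro: card_mono)
  also have "\<dots> = (\<Sum>r\<le>card K. real (card K choose r) * g r)"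
    using assms by (intro sum.cong refl) (simp add: Pow_def n_subsets)
  finally show ?thesis .
qed

lemma power_card_eq_sum_subsets:
  fixes z :: real
  assumes "finite X"
  shows "(1 + z) ^ card X = (\<Sum>T\<in>Pow X. z ^ card T)"
  using prod_add[OF assms, of "\<lambda>_. z" "\<lambda>_. 1"] by (simp add: add.commute)

text \<open>Expanding \<open>(1 + z) ^ |E \<inter> K|\<close> over the subsets \<open>T\<close> of \<open>E \<inter> K\<close> and exchanging the sums, each
  \<open>T \<subseteq> K\<close> contributes \<open>z ^ |T|\<close> as often as there are \<open>m\<close>-sets \<open>E\<close> that contain it.\<close>

lemma sum_power_card_Int:
  assumes "finite V" "K \<subseteq> V" "m \<le> card V"
  shows "(\<Sum>E | E \<subseteq> V \<and> card E = m. (1 + z) ^ card (E \<inter> K)) =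
    real (card V choose m) * hypergeom_gf (card V) (card K) m z"
proof -
  let ?E = "{E. E \<subseteq> V \<and> card E = m}"
  have fin: "finite ?E" "finite K" using assms by (auto intro: finite_subset)
  have "(\<Sum>E\<in>?E. (1 + z) ^ card (E \<inter> K)) = (\<Sum>E\<in>?E. \<Sum>T\<in>Pow (E \<inter> K). z ^ card T)"
    using fin by (intro sum.cong refl power_card_eq_sum_subsets) auto
  also have "\<dots> = (\<Sum>E\<in>?E. \<Sum>T\<in>Pow K. if T \<subseteq> E then z ^ card T else 0)"
    using fin by (intro sum.cong refl sum.mono_neutral_cong_left) auto
  also have "\<dots> = (\<Sum>T\<in>Pow K. \<Sum>E\<in>?E. if T \<subseteq> E then z ^ card T else 0)"
    by (rule sum.swap)
  also have "\<dots> = (\<Sum>T\<in>Pow K. real (card {E. E \<subseteq> V \<and> card E = m \<and> T \<subseteq> E}) * z ^ card T)"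
    using fin by (intro sum.cong refl)
      (auto simp: sum.If_cases Int_def conj_ac intro!: arg_cong[where f = card])
  also have "\<dots> = (\<Sum>T\<in>Pow K. real (card V choose m) *
      (real (m choose card T) / real (card V choose card T)) * z ^ card T)"
    by (intro sum.cong refl arg_cong2[where f = "(*)"] card_supersets) (use assms in auto)
  also have "\<dots> = real (card V choose m) * hypergeom_gf (card V) (card K) m z"
    unfolding hypergeom_gf_def sum_distrib_left
    by (subst sum_Pow_by_card) (use fin in \<open>auto intro!: sum.cong\<close>)
  finally show ?thesis .
qed

lemma binomial_ratio_le_power:
  assumes "k \<le> N"
  shows "real (k choose r) / real (N choose r) \<le> (real k / real N) ^ r"
proof (cases "r \<le> k")
  case True
  have "real (k choose r) / real (N choose r) = (\<Prod>i = 0..<r. real (k - i) / real (N - i))"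
    using True assms by (simp add: binomial_altdef_of_nat prod_dividef)
  also have "\<dots> \<le> (\<Prod>i = 0..<r. real k / real N)"
  proof (rule prod_mono, intro conjI)
    fix i assume "i \<in> {0..<r}"
    then have i: "i < k" using True by auto
    have "real k * i \<le> N * real i" using assms by (simp add: mult_right_mono)
    then show "real (k - i) / real (N - i) \<le> real k / real N"
      using i assms by (simp add: field_simps of_nat_diff)
  qed auto
  finally show ?thesis by simp
next
  case False
  then show ?thesis by (simp add: binomial_eq_0)
qed

lemma hypergeom_term_le:
  assumes "k \<le> N" "0 \<le> z"
  shows "real (k choose r) * real (m choose r) / real (N choose r) * z ^ r
    \<le> (z * real k * real m / real N) ^ r / fact r"
proof -
  have "real ((m choose r) * fact r) \<le> real (m ^ r)"
    using binomial_fact_pow of_nat_mono by blast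
  then have "real (m choose r) \<le> real m ^ r / fact r"
    by (simp add: field_simps)
  then have "real (k choose r) / real (N choose r) * real (m choose r)
      \<le> (real k / real N) ^ r * (real m ^ r / fact r)"
    using binomial_ratio_le_power[OF assms(1)] by (intro mult_mono) auto
  then have "real (k choose r) / real (N choose r) * real (m choose r) * z ^ r
      \<le> (real k / real N) ^ r * (real m ^ r / fact r) * z ^ r"
    using assms by (intro mult_right_mono) auto
  then show ?thesis by (simp add: power_mult_distrib power_divide mult_ac)
qed

lemma hypergeom_gf_le_exp:
  assumes "k \<le> N" "0 \<le> z"
  shows "hypergeom_gf N k m z \<le> exp (z * real k * real m / real N)"
proof -
  let ?x = "z * real k * real m / real N"
  have "hypergeom_gf N k m z \<le> (\<Sum>r\<le>k. ?x ^ r / fact r)"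
    unfolding hypergeom_gf_def by (intro sum_mono hypergeom_term_le assms)
  also have "\<dots> \<le> (\<Sum>r. ?x ^ r / fact r)"
    using assms summable_exp[of ?x]
    by (intro sum_le_suminf) (auto simp: field_simps)
  also have "\<dots> = exp ?x" by (simp add: exp_def divide_inverse mult.commute scaleR_conv_of_real)
  finally show ?thesis .
qed

lemma binomial_times_fact_over_power_tendsto:
  "(\<lambda>m. real (m choose r) * fact r / real m ^ r) \<longlonglongrightarrow> 1"
proof -
  have "(\<lambda>m. \<Prod>i = 0..<r. 1 - real i / real m) \<longlonglongrightarrow> (\<Prod>i = 0..<r. 1 - 0)"
    by (intro tendsto_prod tendsto_diff tendsto_const lim_const_over_n)
  moreover have "\<forall>\<^sub>F m in sequentially.
      (\<Prod>i = 0..<r. 1 - real i / real m) = real (m choose r) * fact r / real m ^ r"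
    using eventually_ge_at_top[of "Suc r"]
  proof eventually_elim
    case (elim m)
    have "real (m choose r) * fact r = (\<Prod>i = 0..<r. real m - real i)"
      by (simp add: binomial_gbinomial gbinomial_prod_rev)
    also have "\<dots> = (\<Prod>i = 0..<r. real m * (1 - real i / real m))"
      using elim by (intro prod.cong) (auto simp: field_simps)
    also have "\<dots> = real m ^ r * (\<Prod>i = 0..<r. 1 - real i / real m)"
      by (simp add: prod.distrib)
    finally show ?case using elim by simp
  qed
  ultimately show ?thesis by (simp add: Lim_transform_eventually)
qed

text \<open>If the expected intersection \<open>K\<^sup>2 / N\<close> converges to \<open>c\<close>, the hypergeometric law approaches the
  Poisson law of mean \<open>c\<close>. Each summand converges, and the bound of \<open>hypergeom_term_le\<close> dominates the
  summands uniformly in \<open>n\<close>, so Tannery's theorem applies.\<close>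

lemma hypergeom_gf_tendsto_exp:
  fixes K N :: "nat \<Rightarrow> nat"
  assumes "0 \<le> z" "filterlim K at_top sequentially" "filterlim N at_top sequentially"
    and le: "\<And>n. K n \<le> N n"
    and lim: "(\<lambda>n. real (K n) ^ 2 / real (N n)) \<longlonglongrightarrow> c"
  shows "(\<lambda>n. hypergeom_gf (N n) (K n) (K n) z) \<longlonglongrightarrow> exp (c * z)"
proof -
  define t where "t r n = real (K n choose r) * real (K n choose r) / real (N n choose r) * z ^ r"
    for r n
  have t_lim: "(\<lambda>n. t r n) \<longlonglongrightarrow> (c * z) ^ r / fact r" for r
  proof -
    define g where "g m = real (m choose r) * fact r / real m ^ r" for m
    have g: "g \<longlonglongrightarrow> 1"
      unfolding g_def by (rule binomial_times_fact_over_power_tendsto)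
    have "(\<lambda>n. g (K n) * g (K n) / g (N n) * (real (K n) ^ 2 / real (N n)) ^ r * z ^ r / fact r)
        \<longlonglongrightarrow> 1 * 1 / 1 * c ^ r * z ^ r / fact r"
      by (intro tendsto_intros filterlim_compose[OF g] assms lim) auto
    moreover have "\<forall>\<^sub>F n in sequentially.
        g (K n) * g (K n) / g (N n) * (real (K n) ^ 2 / real (N n)) ^ r * z ^ r / fact r = t r n"
      using filterlim_at_top[THEN iffD1, OF assms(2), rule_format, of "Suc r"]
    proof eventually_elim
      case (elim n)
      then have "K n > 0" "N n > 0" "N n choose r \<noteq> 0" using le[of n] by auto
      then show ?case
        by (simp add: g_def t_def field_simps power_mult_distrib power2_eq_square)
    qed
    ultimately show ?thesis
      by (auto simp: power_mult_distrib intro: Lim_transform_eventually)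
  qed
  have "eventually (\<lambda>n. real (K n) ^ 2 / real (N n) < c + 1) sequentially"
    using lim by (rule order_tendstoD) auto
  then have bound: "\<forall>\<^sub>F n in sequentially. \<forall>r. norm (t r n) \<le> (z * (c + 1)) ^ r / fact r"
  proof eventually_elim
    case (elim n)
    show ?case
    proof
      fix r
      have "norm (t r n) \<le> (z * real (K n) * real (K n) / real (N n)) ^ r / fact r"
        using hypergeom_term_le[OF le assms(1), of n r] assms(1) by (simp add: t_def)
      also have "\<dots> = (z * (real (K n) ^ 2 / real (N n))) ^ r / fact r"
        by (simp add: power2_eq_square mult.assoc)
      also have "\<dots> \<le> (z * (c + 1)) ^ r / fact r"
        using elim assms(1) by (intro divide_right_mono power_mono mult_left_mono) auto
      finally show "norm (t r n) \<le> (z * (c + 1)) ^ r / fact r" .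
    qed
  qed
  have exp_eq: "(\<Sum>r. x ^ r / fact r) = exp x" for x :: real
    by (simp add: exp_def divide_inverse mult.commute scaleR_conv_of_real)
  have "(\<lambda>n. \<Sum>r. t r n) \<longlonglongrightarrow> (\<Sum>r. (c * z) ^ r / fact r)"
    by (rule tannerys_theorem[where M = "\<lambda>r. (z * (c + 1)) ^ r / fact r",
          THEN conjunct2, THEN conjunct2])
       (use t_lim summable_exp[of "z * (c + 1)"] bound in
        \<open>auto simp: eventually_prod_sequentially eventually_sequentially field_simps\<close>)
  moreover have "(\<Sum>r. t r n) = hypergeom_gf (N n) (K n) (K n) z" for n
    unfolding hypergeom_gf_def t_def by (rule suminf_finite) (auto simp: binomial_eq_0)
  ultimately show ?thesis by (simp add: exp_eq)
qed

section \<open>Avoiding a set of arcs\<close>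

definition avoid :: "(nat \<times> nat) set \<Rightarrow> (nat set set \<times> (nat \<times> nat) set) set" where
  "avoid F = {\<omega>. snd \<omega> \<inter> F = {}}"

definition arcs :: "nat set \<Rightarrow> (nat \<times> nat) set" where
  "arcs e = {(u, v). {u, v} = e}"

definition edges_of :: "(nat \<times> nat) set \<Rightarrow> nat set set" where
  "edges_of F = (\<lambda>(u, v). {u, v}) ` F"

text \<open>At most one of the two arcs on each pair; such a set contains no loops either, so that its arcs
  correspond to edges one to one.\<close>

definition one_way :: "nat \<Rightarrow> (nat \<times> nat) set \<Rightarrow> bool" where
  "one_way n F \<longleftrightarrow> F \<subseteq> {..<n} \<times> {..<n} \<and> (\<forall>u v. (u, v) \<in> F \<longrightarrow> (v, u) \<notin> F)"

lemma vertex_pairsE: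
  assumes "e \<in> vertex_pairs n"
  obtains u v where "u < n" "v < n" "u \<noteq> v" "e = {u, v}"
  using assms by (auto simp: vertex_pairs_def card_2_iff)

lemma arcs_doubleton: "u \<noteq> v \<Longrightarrow> arcs {u, v} = {(u, v), (v, u)}"
  by (auto simp: arcs_def doubleton_eq_iff)

lemma finite_arcs: "e \<in> vertex_pairs n \<Longrightarrow> finite (arcs e)"
  by (elim vertex_pairsE) (simp add: arcs_doubleton)

lemma card_arcs: "e \<in> vertex_pairs n \<Longrightarrow> card (arcs e) = 2"
  by (elim vertex_pairsE) (simp add: arcs_doubleton)

lemma arcs_nonempty: "e \<in> vertex_pairs n \<Longrightarrow> arcs e \<noteq> {}"
  by (elim vertex_pairsE) (simp add: arcs_doubleton)

lemma edges_of_one_way: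
  assumes "one_way n F"
  shows "edges_of F \<subseteq> vertex_pairs n" "card (edges_of F) = card F"
proof -
  show "edges_of F \<subseteq> vertex_pairs n"
    using assms unfolding one_way_def edges_of_def vertex_pairs_def
    by (auto simp: card_insert_if) blast
  have "inj_on (\<lambda>(u, v). {u, v}) F"
    using assms by (auto simp: inj_on_def one_way_def doubleton_eq_iff)
  then show "card (edges_of F) = card F"
    by (simp add: edges_of_def card_image)
qed

lemma card_one_way_le: "one_way n F \<Longrightarrow> card F \<le> n choose 2"
  using edges_of_one_way[of n F] card_mono[OF finite_vertex_pairs] card_vertex_pairs by metis

lemma card_arcs_Int_one_way:
  assumes "one_way n F" "e \<in> vertex_pairs n"
  shows "card (arcs e \<inter> F) = (if e \<in> edges_of F then 1 else 0)"
proof -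
  obtain u v where e: "u \<noteq> v" "e = {u, v}" using assms(2) by (rule vertex_pairsE)
  have iff: "e \<in> edges_of F \<longleftrightarrow> (u, v) \<in> F \<or> (v, u) \<in> F"
    using e by (force simp: edges_of_def doubleton_eq_iff image_iff)
  have "arcs e \<inter> F = (if (u, v) \<in> F then {(u, v)} else if (v, u) \<in> F then {(v, u)} else {})"
    using assms(1) e by (auto simp: arcs_doubleton one_way_def)
  then show ?thesis using iff by auto
qed

lemma pmf_gnp:
  assumes "E \<subseteq> vertex_pairs n" "p \<in> {0..1}"
  shows "pmf (gnp n p) E = p ^ card E * (1 - p) ^ ((n choose 2) - card E)"
proof -
  let ?V = "vertex_pairs n"
  have fin: "finite ?V" "finite E" using assms finite_vertex_pairs finite_subset by auto
  have "pmf (gnp n p) E = measure (Pi_pmf ?V False (\<lambda>_. bernoulli_pmf p))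
      ((\<lambda>f. {e \<in> ?V. f e}) -` {E})"
    by (simp add: gnp_def pmf_map)
  also have "(\<lambda>f. {e \<in> ?V. f e}) -` {E} = Pi ?V (\<lambda>e. {e \<in> E})"
    using assms by (auto simp: Pi_def)
  also have "measure (Pi_pmf ?V False (\<lambda>_. bernoulli_pmf p)) \<dots> =
      (\<Prod>e\<in>?V. if e \<in> E then p else 1 - p)"
    unfolding measure_Pi_pmf_Pi[OF fin(1)]
    using assms by (intro prod.cong refl) (auto simp: measure_pmf_single)
  also have "\<dots> = p ^ card E * (1 - p) ^ ((n choose 2) - card E)"
    using assms fin
    by (simp add: prod.If_cases Int_absorb1 Diff_eq[symmetric] card_Diff_subset card_vertex_pairs)
  finally show ?thesis .
qed

lemma set_pmf_gnp: "set_pmf (gnp n p) \<subseteq> Pow (vertex_pairs n)"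
  by (auto simp: gnp_def)

text \<open>Independence of the edges: the expectation of a product of factors, one for each present edge.\<close>

lemma sum_gnp_prod:
  assumes "p \<in> {0..1}"
  shows "(\<Sum>E\<in>Pow (vertex_pairs n). pmf (gnp n p) E * (\<Prod>e\<in>E. y e)) =
    (\<Prod>e\<in>vertex_pairs n. 1 - p + p * y e)"
proof -
  let ?V = "vertex_pairs n"
  have "(\<Prod>e\<in>?V. p * y e + (1 - p)) =
      (\<Sum>E\<in>Pow ?V. (\<Prod>e\<in>E. p * y e) * (\<Prod>e\<in>?V - E. 1 - p))"
    by (rule prod_add) (rule finite_vertex_pairs)
  also have "\<dots> = (\<Sum>E\<in>Pow ?V. pmf (gnp n p) E * (\<Prod>e\<in>E. y e))"
    using assms finite_vertex_pairs finite_subset[OF _ finite_vertex_pairs]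
    by (intro sum.cong refl)
      (auto simp: pmf_gnp prod.distrib card_Diff_subset card_vertex_pairs)
  finally show ?thesis by (simp add: add.commute)
qed

text \<open>Each edge is oriented independently and hits \<open>F\<close> with probability \<open>0\<close>, \<open>1/2\<close> or \<open>1\<close>, according to
  how many of its two arcs belong to \<open>F\<close>.\<close>

lemma prob_random_orientation_avoid:
  assumes "E \<subseteq> vertex_pairs n"
  shows "measure (random_orientation E) {D. D \<inter> F = {}} =
    (\<Prod>e\<in>E. 1 - real (card (arcs e \<inter> F)) / 2)"
proof -
  have finE: "finite E" using assms finite_vertex_pairs finite_subset by auto
  have "measure (random_orientation E) {D. D \<inter> F = {}} =
      measure (Pi_pmf E undefined (\<lambda>e. pmf_of_set (arcs e))) (Pi E (\<lambda>_. - F))"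
    unfolding random_orientation_def arcs_def
    by (auto simp: Pi_def intro!: arg_cong2[where f = measure])
  also have "\<dots> = (\<Prod>e\<in>E. measure (pmf_of_set (arcs e)) (- F))"
    by (rule measure_Pi_pmf_Pi[OF finE])
  also have "\<dots> = (\<Prod>e\<in>E. 1 - real (card (arcs e \<inter> F)) / 2)"
  proof (rule prod.cong[OF refl])
    fix e assume "e \<in> E"
    then have e: "e \<in> vertex_pairs n" using assms by auto
    have "card (arcs e \<inter> - F) = 2 - card (arcs e \<inter> F)"
      using card_Diff_subset_Int[of "arcs e" F] finite_arcs[OF e] card_arcs[OF e]
      by (simp add: Diff_eq)
    moreover have "card (arcs e \<inter> F) \<le> 2"
      using card_mono[OF finite_arcs[OF e], of "arcs e \<inter> F"] card_arcs[OF e] by simp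
    ultimately show "measure (pmf_of_set (arcs e)) (- F) = 1 - real (card (arcs e \<inter> F)) / 2"
      using finite_arcs[OF e] arcs_nonempty[OF e] card_arcs[OF e]
      by (simp add: measure_pmf_of_set of_nat_diff)
  qed
  finally show ?thesis .
qed

lemma set_pmf_random_orientation:
  assumes "E \<subseteq> vertex_pairs n" "D \<in> set_pmf (random_orientation E)"
  shows "D \<subseteq> {..<n} \<times> {..<n}"
proof -
  have finE: "finite E" using assms finite_vertex_pairs finite_subset by auto
  obtain f where f: "D = f ` E" "\<And>e. e \<in> E \<Longrightarrow> f e \<in> set_pmf (pmf_of_set (arcs e))"
    using assms(2) finE
    by (auto simp: random_orientation_def set_Pi_pmf PiE_dflt_def arcs_def)
  show ?thesis
  proof
    fix x assume "x \<in> D"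
    then obtain e where e: "e \<in> E" "x = f e" using f(1) by auto
    then have eV: "e \<in> vertex_pairs n" using assms by auto
    have "x \<in> arcs e" using e f(2) set_pmf_of_set[OF arcs_nonempty finite_arcs, OF eV eV] by auto
    then show "x \<in> {..<n} \<times> {..<n}" using eV by (auto simp: arcs_def vertex_pairs_def)
  qed
qed

lemma finite_set_pmf_random_orientation:
  "E \<subseteq> vertex_pairs n \<Longrightarrow> finite (set_pmf (random_orientation E))"
  by (rule finite_subset[of _ "Pow ({..<n} \<times> {..<n})"]) (auto dest: set_pmf_random_orientation[THEN subsetD])

lemma set_pmf_oriented_gnp:
  assumes "\<omega> \<in> set_pmf (oriented_gnp n p)"
  shows "fst \<omega> \<subseteq> vertex_pairs n" "snd \<omega> \<subseteq> {..<n} \<times> {..<n}"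
proof -
  obtain E D where ED: "\<omega> = (E, D)" "E \<in> set_pmf (gnp n p)" "D \<in> set_pmf (random_orientation E)"
    using assms by (auto simp: oriented_gnp_def)
  have "E \<subseteq> vertex_pairs n" using ED(2) set_pmf_gnp by auto
  with ED set_pmf_random_orientation[OF this ED(3)]
  show "fst \<omega> \<subseteq> vertex_pairs n" "snd \<omega> \<subseteq> {..<n} \<times> {..<n}" by auto
qed

lemma finite_set_pmf_oriented_gnp: "finite (set_pmf (oriented_gnp n p))"
  by (rule finite_subset[of _ "Pow (vertex_pairs n) \<times> Pow ({..<n} \<times> {..<n})"])
     (intro subsetI, simp add: mem_Times_iff set_pmf_oriented_gnp, simp add: finite_vertex_pairs)

lemma integrable_oriented_gnp [simp]:
  fixes f :: "_ \<Rightarrow> real"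
  shows "integrable (measure_pmf (oriented_gnp n p)) f"
  by (rule integrable_measure_pmf_finite[OF finite_set_pmf_oriented_gnp])

text \<open>Integrating out the orientation. The factor \<open>g\<close> is what makes this usable for conditioning on the
  number of edges: as an indicator it selects the graphs with a given number of edges, and as a function
  of that number it yields products of conditional probabilities.\<close>

lemma expectation_indicator_avoid:
  fixes g :: "nat \<Rightarrow> real"
  shows "measure_pmf.expectation (oriented_gnp n p)
      (\<lambda>\<omega>. indicator (avoid F) \<omega> * g (num_edges \<omega>)) =
    (\<Sum>E\<in>Pow (vertex_pairs n). pmf (gnp n p) E *
      ((\<Prod>e\<in>E. 1 - real (card (arcs e \<inter> F)) / 2) * g (card E)))"
proof -
  have "measure_pmf.expectation (oriented_gnp n p)
      (\<lambda>\<omega>. indicator (avoid F) \<omega> * g (num_edges \<omega>)) =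
    (\<Sum>E\<in>Pow (vertex_pairs n). pmf (gnp n p) E *\<^sub>R
      measure_pmf.expectation (map_pmf (\<lambda>D. (E, D)) (random_orientation E))
      (\<lambda>\<omega>. indicator (avoid F) \<omega> * g (num_edges \<omega>)))"
    unfolding oriented_gnp_def
    by (rule pmf_expectation_bind)
      (use set_pmf_gnp finite_vertex_pairs finite_set_pmf_random_orientation in auto)
  also have "\<dots> = (\<Sum>E\<in>Pow (vertex_pairs n). pmf (gnp n p) E *
      ((\<Prod>e\<in>E. 1 - real (card (arcs e \<inter> F)) / 2) * g (card E)))"
  proof (intro sum.cong refl)
    fix E assume "E \<in> Pow (vertex_pairs n)"
    moreover have "measure_pmf.expectation (map_pmf (\<lambda>D. (E, D)) (random_orientation E))
        (\<lambda>\<omega>. indicator (avoid F) \<omega> * g (num_edges \<omega>)) =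
      measure_pmf.expectation (random_orientation E)
        (\<lambda>D. indicator {D. D \<inter> F = {}} D * g (card E))"
      by (simp add: num_edges_def avoid_def indicator_def)
    ultimately show "pmf (gnp n p) E *\<^sub>R
        measure_pmf.expectation (map_pmf (\<lambda>D. (E, D)) (random_orientation E))
        (\<lambda>\<omega>. indicator (avoid F) \<omega> * g (num_edges \<omega>)) =
      pmf (gnp n p) E * ((\<Prod>e\<in>E. 1 - real (card (arcs e \<inter> F)) / 2) * g (card E))"
      using prob_random_orientation_avoid[of E n F] by simp
  qed
  finally show ?thesis .
qed

lemma prob_avoid:
  assumes "p \<in> {0..1}"
  shows "measure (oriented_gnp n p) (avoid F) =
    (\<Prod>e\<in>vertex_pairs n. 1 - p * real (card (arcs e \<inter> F)) / 2)"
proof -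
  have "measure (oriented_gnp n p) (avoid F) =
      (\<Prod>e\<in>vertex_pairs n. 1 - p + p * (1 - real (card (arcs e \<inter> F)) / 2))"
    using expectation_indicator_avoid[of n p F "\<lambda>_. 1"] sum_gnp_prod[OF assms] by simp
  then show ?thesis by (simp add: algebra_simps)
qed

lemma prod_if_mem_eq_power:
  fixes x :: real
  assumes "finite V" "K \<subseteq> V"
  shows "(\<Prod>e\<in>V. if e \<in> K then x else 1) = x ^ card K"
  using assms by (simp add: prod.If_cases Int_absorb1)

lemma prob_avoid_one_way:
  assumes "p \<in> {0..1}" "one_way n F"
  shows "measure (oriented_gnp n p) (avoid F) = (1 - p / 2) ^ card F"
proof -
  have "measure (oriented_gnp n p) (avoid F) =
      (\<Prod>e\<in>vertex_pairs n. if e \<in> edges_of F then 1 - p / 2 else 1)"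
    unfolding prob_avoid[OF assms(1)]
    by (intro prod.cong refl) (simp add: card_arcs_Int_one_way[OF assms(2)])
  then show ?thesis
    using edges_of_one_way[OF assms(2)] by (simp add: prod_if_mem_eq_power finite_vertex_pairs)
qed

lemma prod_one_way_eq_power:
  assumes "one_way n F" "E \<subseteq> vertex_pairs n"
  shows "(\<Prod>e\<in>E. 1 - real (card (arcs e \<inter> F)) / 2) = (1 / 2) ^ card (E \<inter> edges_of F)"
proof -
  have "(\<Prod>e\<in>E. 1 - real (card (arcs e \<inter> F)) / 2) =
      (\<Prod>e\<in>E. if e \<in> E \<inter> edges_of F then 1 / 2 else 1)"
    using assms(2) by (intro prod.cong refl) (auto simp: card_arcs_Int_one_way[OF assms(1)])
  also have "\<dots> = (1 / 2) ^ card (E \<inter> edges_of F)"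
    using assms(2) finite_vertex_pairs finite_subset by (intro prod_if_mem_eq_power) auto
  finally show ?thesis .
qed

lemma prob_avoid_and_num_edges:
  assumes "p \<in> {0..1}" "one_way n F" "m \<le> n choose 2"
  shows "measure (oriented_gnp n p) {\<eta>. \<eta> \<in> avoid F \<and> num_edges \<eta> = m} =
    p ^ m * (1 - p) ^ ((n choose 2) - m) * real ((n choose 2) choose m) *
      hypergeom_gf (n choose 2) (card F) m (- 1 / 2)"
proof -
  let ?V = "vertex_pairs n" and ?w = "p ^ m * (1 - p) ^ ((n choose 2) - m)"
  have "measure (oriented_gnp n p) {\<eta>. \<eta> \<in> avoid F \<and> num_edges \<eta> = m} =
      measure_pmf.expectation (oriented_gnp n p)
        (indicator {\<eta>. \<eta> \<in> avoid F \<and> num_edges \<eta> = m})"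
    by simp
  also have "\<dots> = measure_pmf.expectation (oriented_gnp n p)
      (\<lambda>\<omega>. indicator (avoid F) \<omega> * indicator {m} (num_edges \<omega>))"
    by (intro Bochner_Integration.integral_cong) (auto simp: indicator_def)
  also have "\<dots> = (\<Sum>E\<in>Pow ?V. pmf (gnp n p) E *
      ((\<Prod>e\<in>E. 1 - real (card (arcs e \<inter> F)) / 2) * indicator {m} (card E)))"
    by (rule expectation_indicator_avoid)
  also have "\<dots> = (\<Sum>E | E \<subseteq> ?V \<and> card E = m. ?w * (1 + (- 1 / 2)) ^ card (E \<inter> edges_of F))"
    using assms finite_vertex_pairs
    by (intro sum.mono_neutral_cong_right)
      (auto simp: prod_one_way_eq_power pmf_gnp)
  also have "\<dots> = ?w * (real ((n choose 2) choose m) *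
      hypergeom_gf (n choose 2) (card F) m (- 1 / 2))"
    unfolding sum_distrib_left[symmetric]
    using edges_of_one_way[OF assms(2)] finite_vertex_pairs assms(3)
    by (subst sum_power_card_Int[of ?V]) (auto simp: card_vertex_pairs)
  finally show ?thesis by simp
qed

lemma num_edges_le:
  assumes "\<omega> \<in> set_pmf (oriented_gnp n p)"
  shows "num_edges \<omega> \<le> n choose 2"
  using set_pmf_oriented_gnp(1)[OF assms] card_mono[OF finite_vertex_pairs]
  by (metis card_vertex_pairs num_edges_def)

lemma prob_level_set_pos:
  assumes "\<omega> \<in> set_pmf P"
  shows "0 < measure (measure_pmf P) {\<eta>. X \<eta> = X \<omega>}"
proof -
  have "0 < pmf P \<omega>" using assms by (simp add: pmf_positive)
  also have "\<dots> = measure P {\<omega>}" by (simp add: measure_pmf_single)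
  also have "\<dots> \<le> measure P {\<eta>. X \<eta> = X \<omega>}"
    by (intro measure_pmf.finite_measure_mono) auto
  finally show ?thesis .
qed

section \<open>Products of conditional probabilities\<close>

text \<open>Given the number of edges, the edge set is uniform, so the number of its edges on the pairs of
  \<open>F\<close> is hypergeometric, and each of them is oriented away from \<open>F\<close> with probability \<open>1/2\<close>. The
  equation is restricted to the support because \<open>prob_given\<close> is \<open>0\<close> where the condition has
  probability \<open>0\<close>; for \<open>p = 1\<close> all conditions but one are of this kind.\<close>

lemma prob_given_avoid:
  assumes "p \<in> {0..1}" "one_way n F" "\<omega> \<in> set_pmf (oriented_gnp n p)"
  shows "prob_given (oriented_gnp n p) (avoid F) num_edges \<omega> =
    hypergeom_gf (n choose 2) (card F) (num_edges \<omega>) (- 1 / 2)"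
proof -
  let ?P = "oriented_gnp n p" and ?m = "num_edges \<omega>"
  have "measure ?P {\<eta>. num_edges \<eta> = ?m} =
      measure ?P {\<eta>. \<eta> \<in> avoid {} \<and> num_edges \<eta> = ?m}"
    by (simp add: avoid_def)
  also have "\<dots> = p ^ ?m * (1 - p) ^ ((n choose 2) - ?m) * real ((n choose 2) choose ?m)"
    using prob_avoid_and_num_edges[OF assms(1) _ num_edges_le[OF assms(3)], of "{}"]
    by (simp add: one_way_def hypergeom_gf_def)
  finally have m: "measure ?P {\<eta>. num_edges \<eta> = ?m} =
      p ^ ?m * (1 - p) ^ ((n choose 2) - ?m) * real ((n choose 2) choose ?m)" .
  have "measure ?P {\<eta>. num_edges \<eta> = ?m} \<noteq> 0"
    using prob_level_set_pos[OF assms(3), of num_edges] by simp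
  moreover have "measure ?P {\<eta>. \<eta> \<in> avoid F \<and> num_edges \<eta> = ?m} =
      measure ?P {\<eta>. num_edges \<eta> = ?m} * hypergeom_gf (n choose 2) (card F) ?m (- 1 / 2)"
    unfolding m by (rule prob_avoid_and_num_edges[OF assms(1,2) num_edges_le[OF assms(3)]])
  ultimately show ?thesis
    by (simp add: prob_given_def cond_prob_def)
qed

text \<open>The tower property: a conditional probability given \<open>X\<close> may be replaced by the indicator of the
  event under an expectation against any function of \<open>X\<close>.\<close>

lemma expectation_prob_given_mult:
  fixes g :: "'b \<Rightarrow> real"
  assumes fin: "finite (set_pmf P)"
  shows "measure_pmf.expectation P (\<lambda>\<omega>. prob_given P A X \<omega> * g (X \<omega>)) =
    measure_pmf.expectation P (\<lambda>\<omega>. indicator A \<omega> * g (X \<omega>))"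
proof -
  let ?Q = "\<lambda>x. measure P {\<eta>. X \<eta> = x}"
  define c where "c x = measure P {\<eta>. \<eta> \<in> A \<and> X \<eta> = x} / ?Q x" for x
  have finX: "finite (X ` set_pmf P)" using fin by simp
  have "measure_pmf.expectation P (\<lambda>\<omega>. prob_given P A X \<omega> * g (X \<omega>)) =
      measure_pmf.expectation (map_pmf X P) (\<lambda>x. c x * g x)"
    by (simp add: prob_given_def cond_prob_def c_def)
  also have "\<dots> = (\<Sum>x\<in>X ` set_pmf P. c x * g x * pmf (map_pmf X P) x)"
    by (rule integral_measure_pmf_real[OF finX]) auto
  also have "\<dots> = (\<Sum>x\<in>X ` set_pmf P. measure P {\<eta>. \<eta> \<in> A \<and> X \<eta> = x} * g x)"
    using prob_level_set_pos[of _ P X]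
    by (intro sum.cong refl) (force simp: c_def pmf_map vimage_def)
  also have "\<dots> = (\<Sum>x\<in>X ` set_pmf P. measure_pmf.expectation P
      (\<lambda>\<omega>. indicator {\<eta>. \<eta> \<in> A \<and> X \<eta> = x} \<omega> * g x))"
    by simp
  also have "\<dots> = measure_pmf.expectation P
      (\<lambda>\<omega>. \<Sum>x\<in>X ` set_pmf P. indicator {\<eta>. \<eta> \<in> A \<and> X \<eta> = x} \<omega> * g x)"
    by (rule Bochner_Integration.integral_sum[symmetric])
      (rule integrable_measure_pmf_finite[OF fin])
  also have "\<dots> = measure_pmf.expectation P (\<lambda>\<omega>. indicator A \<omega> * g (X \<omega>))"
  proof (rule integral_cong_AE)
    show "AE \<omega> in P. (\<Sum>x\<in>X ` set_pmf P. indicator {\<eta>. \<eta> \<in> A \<and> X \<eta> = x} \<omega> * g x) =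
        indicator A \<omega> * g (X \<omega>)"
    proof (rule AE_pmfI)
      fix \<omega> assume "\<omega> \<in> set_pmf P"
      have "(\<Sum>x\<in>X ` set_pmf P. indicator {\<eta>. \<eta> \<in> A \<and> X \<eta> = x} \<omega> * g x) =
          sum (\<lambda>x. indicator A \<omega> * g x) {X \<omega>}"
        using finX \<open>\<omega> \<in> set_pmf P\<close> by (intro sum.mono_neutral_cong_right) (auto simp: indicator_def)
      then show "(\<Sum>x\<in>X ` set_pmf P. indicator {\<eta>. \<eta> \<in> A \<and> X \<eta> = x} \<omega> * g x) =
          indicator A \<omega> * g (X \<omega>)" by (subst (asm) sum.insert) auto
    qed
  qed auto
  finally show ?thesis .
qed

lemma expectation_prob_given:
  assumes "finite (set_pmf P)"
  shows "measure_pmf.expectation P (prob_given P A X) = measure P A"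
  using expectation_prob_given_mult[OF assms, of A X "\<lambda>_. 1"] by simp

text \<open>The second moment formula on which both asymptotics rest. One of the two conditional probabilities
  is turned back into an indicator by the tower property. The other one, by symmetry of the
  hypergeometric generating function, is an average over all sets \<open>J\<close> of \<open>|G|\<close> pairs. For each \<open>J\<close>
  what remains is a product over independent edges, in which a pair in exactly one of \<open>K\<close> and \<open>J\<close>
  contributes \<open>q\<close> and a pair in both contributes \<open>1 - p + p/4 = q\<^sup>2 (1 + \<theta>)\<close>.\<close>

lemma expectation_prob_given_avoid_mult:
  assumes p: "p \<in> {0..1}" and F: "one_way n F" and G: "one_way n G"
  shows "measure_pmf.expectation (oriented_gnp n p)
      (\<lambda>\<omega>. prob_given (oriented_gnp n p) (avoid F) num_edges \<omega> *
           prob_given (oriented_gnp n p) (avoid G) num_edges \<omega>) =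
    (1 - p / 2) ^ (card F + card G) *
      hypergeom_gf (n choose 2) (card F) (card G) (p * (1 - p) / (2 - p)\<^sup>2)"
proof -
  let ?P = "oriented_gnp n p" and ?V = "vertex_pairs n" and ?N = "n choose 2"
  define q where "q = 1 - p / 2"
  define \<theta> where "\<theta> = p * (1 - p) / (2 - p)\<^sup>2"
  define k where "k = card F"
  define j where "j = card G"
  define K where "K = edges_of F"
  define \<J> where "\<J> = {J. J \<subseteq> ?V \<and> card J = j}"
  note finV = finite_vertex_pairs[of n]
  have K: "K \<subseteq> ?V" "card K = k" using edges_of_one_way[OF F] by (auto simp: K_def k_def)
  have "q > 0" using p by (simp add: q_def)
  have q2: "1 - p + p * (1 / 4) = q * q * (1 + \<theta>)"
  proof -
    have qq: "q * q = (2 - p)\<^sup>2 / 4" by (simp add: q_def power2_eq_square field_simps)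
    have "q * q * \<theta> = p * (1 - p) / 4"
      unfolding qq using p by (simp add: \<theta>_def)
    then show ?thesis by (simp add: distrib_left qq power2_eq_square) (simp add: field_simps)
  qed
  have jN: "j \<le> ?N" using card_one_way_le[OF G] by (simp add: j_def)
  \<comment> \<open>The exchange of roles: now the edge set \<open>E\<close> is fixed and the set of pairs is random.\<close>
  have h: "hypergeom_gf ?N j (card E) (- (1 / 2)) =
      (\<Sum>J\<in>\<J>. (1 / 2) ^ card (E \<inter> J)) / real (?N choose j)" if "E \<subseteq> ?V" for E
  proof -
    have "(\<Sum>J\<in>\<J>. (1 + - 1 / 2) ^ card (J \<inter> E)) =
        real (?N choose j) * hypergeom_gf ?N (card E) j (- 1 / 2)"
      unfolding \<J>_def using sum_power_card_Int[OF finV that, of j "- 1 / 2"] jN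
      by (simp add: card_vertex_pairs)
    then show ?thesis
      using jN by (simp add: hypergeom_gf_commute[of _ j] Int_commute)
  qed
  have "measure_pmf.expectation ?P (\<lambda>\<omega>. prob_given ?P (avoid F) num_edges \<omega> *
           prob_given ?P (avoid G) num_edges \<omega>) =
      measure_pmf.expectation ?P (\<lambda>\<omega>. prob_given ?P (avoid F) num_edges \<omega> *
           hypergeom_gf ?N j (num_edges \<omega>) (- 1 / 2))"
    by (rule integral_cong_AE) (auto intro!: AE_pmfI simp: prob_given_avoid[OF p G] j_def)
  also have "\<dots> = measure_pmf.expectation ?P (\<lambda>\<omega>. indicator (avoid F) \<omega> *
           hypergeom_gf ?N j (num_edges \<omega>) (- 1 / 2))"
    by (rule expectation_prob_given_mult[OF finite_set_pmf_oriented_gnp])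
  also have "\<dots> = (\<Sum>E\<in>Pow ?V. pmf (gnp n p) E *
      ((1 / 2) ^ card (E \<inter> K) * ((\<Sum>J\<in>\<J>. (1 / 2) ^ card (E \<inter> J)) / real (?N choose j))))"
    by (subst expectation_indicator_avoid[where g = "\<lambda>m. hypergeom_gf ?N j m (- 1 / 2)"],
        intro sum.cong refl) (simp add: h prod_one_way_eq_power[OF F] K_def)
  also have "\<dots> = (\<Sum>J\<in>\<J>. \<Sum>E\<in>Pow ?V. pmf (gnp n p) E *
      ((1 / 2) ^ card (E \<inter> K) * (1 / 2) ^ card (E \<inter> J))) / real (?N choose j)"
    by (subst sum.swap) (simp add: sum_distrib_left sum_divide_distrib mult_ac)
  also have "(\<Sum>J\<in>\<J>. \<Sum>E\<in>Pow ?V. pmf (gnp n p) E *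
      ((1 / 2) ^ card (E \<inter> K) * (1 / 2) ^ card (E \<inter> J))) =
      (\<Sum>J\<in>\<J>. q ^ (k + j) * (1 + \<theta>) ^ card (J \<inter> K))"
  proof (rule sum.cong[OF refl])
    fix J assume "J \<in> \<J>"
    then have J: "J \<subseteq> ?V" "card J = j" by (auto simp: \<J>_def)
    define y :: "nat set \<Rightarrow> real" where
      "y e = (if e \<in> K then 1 / 2 else 1) * (if e \<in> J then 1 / 2 else 1)" for e
    have "(\<Sum>E\<in>Pow ?V. pmf (gnp n p) E * ((1 / 2) ^ card (E \<inter> K) * (1 / 2) ^ card (E \<inter> J))) =
        (\<Sum>E\<in>Pow ?V. pmf (gnp n p) E * (\<Prod>e\<in>E. y e))"
    proof (intro sum.cong refl arg_cong2[where f = "(*)"])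
      fix E assume "E \<in> Pow ?V"
      then have "finite E" using finV finite_subset by auto
      then show "(1 / 2) ^ card (E \<inter> K) * (1 / 2) ^ card (E \<inter> J) = (\<Prod>e\<in>E. y e)"
        by (simp add: y_def prod.distrib prod.If_cases)
    qed
    also have "\<dots> = (\<Prod>e\<in>?V. 1 - p + p * y e)"
      by (rule sum_gnp_prod[OF p])
    also have "\<dots> = (\<Prod>e\<in>?V. (if e \<in> K then q else 1) * (if e \<in> J then q else 1) *
        (if e \<in> J \<inter> K then 1 + \<theta> else 1))"
      using q2 by (intro prod.cong refl) (auto simp: y_def q_def)
    also have "\<dots> = q ^ (k + j) * (1 + \<theta>) ^ card (J \<inter> K)"
      using finV J K by (simp add: prod.distrib prod_if_mem_eq_power le_infI2 power_add
          del: Int_iff)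
    finally show "(\<Sum>E\<in>Pow ?V. pmf (gnp n p) E *
        ((1 / 2) ^ card (E \<inter> K) * (1 / 2) ^ card (E \<inter> J))) =
        q ^ (k + j) * (1 + \<theta>) ^ card (J \<inter> K)" .
  qed
  also have "(\<Sum>J\<in>\<J>. q ^ (k + j) * (1 + \<theta>) ^ card (J \<inter> K)) =
      q ^ (k + j) * (real (?N choose j) * hypergeom_gf ?N k j \<theta>)"
    unfolding sum_distrib_left[symmetric] \<J>_def
    using sum_power_card_Int[OF finV K(1), of j \<theta>] jN K(2) by (simp add: card_vertex_pairs)
  finally show ?thesis
    using jN by (simp add: q_def \<theta>_def k_def j_def)
qed

section \<open>Elementary bounds for conditional probabilities\<close>

lemma prob_le_sum:
  assumes "finite I" "\<And>\<omega>. \<omega> \<in> set_pmf P \<Longrightarrow> \<omega> \<in> A \<Longrightarrow> \<exists>i\<in>I. \<omega> \<in> B i"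
  shows "measure (measure_pmf P) A \<le> (\<Sum>i\<in>I. measure (measure_pmf P) (B i))"
proof -
  have "measure P A = measure P (A \<inter> set_pmf P)" by (simp add: measure_Int_set_pmf)
  also have "\<dots> \<le> measure P (\<Union>i\<in>I. B i)"
    by (rule measure_pmf.finite_measure_mono) (use assms(2) in auto)
  also have "\<dots> \<le> (\<Sum>i\<in>I. measure P (B i))"
    by (rule measure_pmf.finite_measure_subadditive_finite) (use assms(1) in auto)
  finally show ?thesis .
qed

lemma prob_given_eq:
  "prob_given P A X \<omega> =
    measure P (A \<inter> {\<eta>. X \<eta> = X \<omega>}) / measure P {\<eta>. X \<eta> = X \<omega>}"
  by (simp add: prob_given_def cond_prob_def Int_def)

lemma prob_given_nonneg: "0 \<le> prob_given P A X \<omega>"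
  by (simp add: prob_given_eq)

lemma prob_given_mono: "A \<subseteq> B \<Longrightarrow> prob_given P A X \<omega> \<le> prob_given P B X \<omega>"
  unfolding prob_given_eq
  by (intro divide_right_mono measure_pmf.finite_measure_mono) auto

lemma prob_given_le_sum:
  assumes "finite I" "\<And>\<omega>. \<omega> \<in> set_pmf P \<Longrightarrow> \<omega> \<in> A \<Longrightarrow> \<exists>i\<in>I. \<omega> \<in> B i"
  shows "prob_given P A X \<omega> \<le> (\<Sum>i\<in>I. prob_given P (B i) X \<omega>)"
  unfolding prob_given_eq sum_divide_distrib[symmetric]
  using assms(2) by (intro divide_right_mono prob_le_sum[OF assms(1)]) auto

lemma prob_ge_two:
  assumes "\<And>\<omega>. \<omega> \<in> set_pmf P \<Longrightarrow> \<omega> \<in> B \<union> C \<Longrightarrow> \<omega> \<in> A"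
  shows "measure (measure_pmf P) B + measure (measure_pmf P) C - measure (measure_pmf P) (B \<inter> C)
    \<le> measure (measure_pmf P) A"
proof -
  have "measure P B + measure P C - measure P (B \<inter> C) = measure P (B \<union> C)"
    by (subst measure_pmf.finite_measure_Union') (auto simp: measure_pmf.finite_measure_Diff' Int_commute)
  also have "\<dots> = measure P ((B \<union> C) \<inter> set_pmf P)" by (simp add: measure_Int_set_pmf)
  also have "\<dots> \<le> measure P A"
    by (rule measure_pmf.finite_measure_mono) (use assms in auto)
  finally show ?thesis .
qed

lemma prob_given_ge_two:
  assumes "\<And>\<omega>. \<omega> \<in> set_pmf P \<Longrightarrow> \<omega> \<in> B \<union> C \<Longrightarrow> \<omega> \<in> A"
  shows "prob_given P B X \<omega> + prob_given P C X \<omega> - prob_given P (B \<inter> C) X \<omega>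
    \<le> prob_given P A X \<omega>"
proof -
  let ?D = "{\<eta>. X \<eta> = X \<omega>}"
  have "measure P (B \<inter> ?D) + measure P (C \<inter> ?D) - measure P ((B \<inter> ?D) \<inter> (C \<inter> ?D)) \<le>
      measure P (A \<inter> ?D)"
    by (rule prob_ge_two) (use assms in auto)
  then have "(measure P (B \<inter> ?D) + measure P (C \<inter> ?D) - measure P ((B \<inter> ?D) \<inter> (C \<inter> ?D))) /
      measure P ?D \<le> measure P (A \<inter> ?D) / measure P ?D"
    by (rule divide_right_mono) simp
  moreover have "(B \<inter> ?D) \<inter> (C \<inter> ?D) = (B \<inter> C) \<inter> ?D" by auto
  ultimately show ?thesis
    unfolding prob_given_eq by (simp add: diff_divide_distrib add_divide_distrib)
qed

section \<open>Separating cuts\<close>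

definition cut_arcs :: "nat \<Rightarrow> nat set \<Rightarrow> (nat \<times> nat) set" where
  "cut_arcs n S = S \<times> ({..<n} - S)"

definition separators :: "nat \<Rightarrow> nat \<Rightarrow> nat \<Rightarrow> nat set set" where
  "separators n u v = {S. S \<subseteq> {..<n} \<and> u \<in> S \<and> v \<notin> S}"

lemma finite_separators [simp]: "finite (separators n u v)"
  by (rule finite_subset[of _ "Pow {..<n}"]) (auto simp: separators_def)

lemma one_way_cut_arcs: "S \<subseteq> {..<n} \<Longrightarrow> one_way n (cut_arcs n S)"
  by (auto simp: one_way_def cut_arcs_def)

lemma card_cut_arcs:
  assumes "S \<subseteq> {..<n}"
  shows "card (cut_arcs n S) = card S * (n - card S)"
proof -
  have "finite S" using assms finite_subset by blast
  then show ?thesis using assms by (simp add: cut_arcs_def card_Diff_subset)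
qed

text \<open>For the cut take the set of vertices that can be reached from \<open>u\<close>.\<close>

lemma no_path_iff_avoid_cut:
  assumes "snd \<omega> \<subseteq> {..<n} \<times> {..<n}" "u < n"
  shows "\<omega> \<in> no_path u v \<longleftrightarrow> (\<exists>S\<in>separators n u v. \<omega> \<in> avoid (cut_arcs n S))"
proof
  assume "\<omega> \<in> no_path u v"
  define S where "S = (snd \<omega>)\<^sup>* `` {u}"
  have "y < n" if "(u, y) \<in> (snd \<omega>)\<^sup>*" for y
    using that by (induction rule: rtrancl_induct) (use assms in auto)
  then have "S \<in> separators n u v"
    using \<open>\<omega> \<in> no_path u v\<close> by (auto simp: S_def separators_def no_path_def)
  moreover have "\<omega> \<in> avoid (cut_arcs n S)"
    by (auto simp: avoid_def cut_arcs_def S_def intro: rtrancl.rtrancl_into_rtrancl)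
  ultimately show "\<exists>S\<in>separators n u v. \<omega> \<in> avoid (cut_arcs n S)" by blast
next
  assume "\<exists>S\<in>separators n u v. \<omega> \<in> avoid (cut_arcs n S)"
  then obtain S where S: "u \<in> S" "v \<notin> S" "\<omega> \<in> avoid (cut_arcs n S)"
    by (auto simp: separators_def)
  have "y \<in> S" if "(u, y) \<in> (snd \<omega>)\<^sup>*" for y
    using that by (induction rule: rtrancl_induct)
      (use S assms in \<open>auto simp: avoid_def cut_arcs_def\<close>)
  then show "\<omega> \<in> no_path u v" using S by (auto simp: no_path_def)
qed

lemma no_path_iff_avoid_cut':
  assumes "\<omega> \<in> set_pmf (oriented_gnp n p)" "u < n"
  shows "\<omega> \<in> no_path u v \<longleftrightarrow> (\<exists>S\<in>separators n u v. \<omega> \<in> avoid (cut_arcs n S))"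
  using no_path_iff_avoid_cut set_pmf_oriented_gnp(2)[OF assms(1)] assms(2) .

text \<open>The union bound for the cuts that have at least \<open>j\<close> vertices on either side.\<close>

definition cut_sum :: "nat \<Rightarrow> nat \<Rightarrow> real \<Rightarrow> real" where
  "cut_sum j n x = (\<Sum>S | S \<subseteq> {..<n} \<and> j \<le> card S \<and> card S + j \<le> n. x ^ (card S * (n - card S)))"

lemma finite_cuts [simp]: "finite {S. S \<subseteq> {..<n} \<and> P S}"
  for n :: nat
  by (rule finite_subset[of _ "Pow {..<n}"]) auto

lemma cut_sum_nonneg: "0 \<le> x \<Longrightarrow> 0 \<le> cut_sum j n x"
  by (simp add: cut_sum_def sum_nonneg)

lemma cut_sum_mono: "0 \<le> x \<Longrightarrow> x \<le> y \<Longrightarrow> cut_sum j n x \<le> cut_sum j n y"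
  by (auto simp: cut_sum_def intro!: sum_mono power_mono)

lemma cut_sum_eq: "cut_sum j n x = (\<Sum>k | j \<le> k \<and> k + j \<le> n. real (n choose k) * x ^ (k * (n - k)))"
proof -
  let ?C = "{S. S \<subseteq> {..<n} \<and> j \<le> card S \<and> card S + j \<le> n}"
  let ?K = "{k. j \<le> k \<and> k + j \<le> n}"
  have K: "finite ?K" by (rule finite_subset[of _ "{..n}"]) auto
  have "cut_sum j n x = (\<Sum>k\<in>?K. \<Sum>S\<in>{S \<in> ?C. card S = k}. x ^ (card S * (n - card S)))"
    unfolding cut_sum_def by (rule sum.group[symmetric]) (use K in auto)
  also have "\<dots> = (\<Sum>k\<in>?K. real (n choose k) * x ^ (k * (n - k)))"
  proof (rule sum.cong[OF refl])
    fix k assume "k \<in> ?K"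
    then have "{S \<in> ?C. card S = k} = {S. S \<subseteq> {..<n} \<and> card S = k}" by auto
    then show "(\<Sum>S\<in>{S \<in> ?C. card S = k}. x ^ (card S * (n - card S))) =
        real (n choose k) * x ^ (k * (n - k))"
      by (simp add: n_subsets)
  qed
  finally show ?thesis .
qed

lemma binomial_le_power_min: "k \<le> n \<Longrightarrow> n choose k \<le> n ^ min k (n - k)"
  using binomial_le_pow[of k n] binomial_le_pow[of "n - k" n] binomial_symmetric[of k n]
  by (simp add: min_def)

text \<open>The cuts with \<open>j\<close> vertices on one side dominate. A cut with \<open>j + t\<close> vertices on its smaller side
  has at most \<open>n ^ (j + t)\<close> choices, which costs \<open>n ^ t\<close> more than for \<open>t = 0\<close>, but forbids at least
  \<open>t ((n - 2 j) div 2)\<close> further arcs; by hypothesis the latter outweighs the former.\<close>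

lemma cut_sum_le:
  assumes x: "0 \<le> x" "x \<le> 1" and small: "real n * x ^ ((n - 2 * j) div 2) \<le> 1"
  shows "cut_sum j n x \<le> real (n + 1) * real n ^ j * x ^ (j * (n - j))"
proof -
  let ?K = "{k. j \<le> k \<and> k + j \<le> n}"
  have "real (n choose k) * x ^ (k * (n - k)) \<le> real n ^ j * x ^ (j * (n - j))" if "k \<in> ?K" for k
  proof -
    obtain i l where k: "k = j + i" "n = k + (j + l)"
      using \<open>k \<in> ?K\<close> by (intro that[of "k - j" "n - k - j"]) auto
    define t where "t = min i l"
    have il: "t * ((i + l) div 2) \<le> i * l"
    proof -
      have "(i + l) div 2 \<le> max i l" by linarith
      then have "t * ((i + l) div 2) \<le> min i l * max i l" by (simp add: t_def)
      also have "\<dots> = i * l" by (simp add: min_def max_def)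
      finally show ?thesis .
    qed
    have "real (n choose k) \<le> real (n ^ (j + t))"
      using binomial_le_power_min[of k n] k by (simp only: of_nat_le_iff) (simp add: t_def)
    moreover have "x ^ (k * (n - k)) \<le> x ^ (j * (n - j) + t * ((i + l) div 2))"
      using x il k by (intro power_decreasing) (auto simp: algebra_simps)
    ultimately have "real (n choose k) * x ^ (k * (n - k)) \<le>
        real (n ^ (j + t)) * x ^ (j * (n - j) + t * ((i + l) div 2))"
      using x by (intro mult_mono) auto
    also have "\<dots> = real n ^ j * x ^ (j * (n - j)) * (real n * x ^ ((i + l) div 2)) ^ t"
      by (simp add: power_add power_mult_distrib power_mult[of x _ t, symmetric] mult.commute[of t])
    also have "\<dots> \<le> real n ^ j * x ^ (j * (n - j)) * 1"
      using small k x by (intro mult_left_mono power_le_one) auto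
    finally show ?thesis by simp
  qed
  then have "cut_sum j n x \<le> (\<Sum>k\<in>?K. real n ^ j * x ^ (j * (n - j)))"
    unfolding cut_sum_eq by (intro sum_mono) auto
  also have "\<dots> = real (card ?K) * (real n ^ j * x ^ (j * (n - j)))" by simp
  also have "\<dots> \<le> real (n + 1) * (real n ^ j * x ^ (j * (n - j)))"
  proof (intro mult_right_mono)
    have "card ?K \<le> card {..n}" by (rule card_mono) auto
    then show "real (card ?K) \<le> real (n + 1)" by simp
  qed (use x in auto)
  finally show ?thesis by (simp add: mult.assoc)
qed

section \<open>The rate of decay in mean square\<close>

text \<open>The quantity \<open>\<theta>\<close>: with \<open>X\<close> the indicator of an edge, the factor \<open>1 - X/2\<close> has mean \<open>q\<close> and second
  moment \<open>q\<^sup>2 (1 + \<theta>)\<close>, so that \<open>\<theta>\<close> is its relative variance.\<close>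

definition corr :: "real \<Rightarrow> real" where
  "corr p = p * (1 - p) / (2 - p)\<^sup>2"

text \<open>Every pair on which an arc is forbidden costs a factor of at most this size in mean square, even
  after conditioning on the number of edges; see \<open>pair_moment_le\<close>.\<close>

definition rate :: "real \<Rightarrow> real" where
  "rate p = (1 - p / 2) * exp (corr p / 2)"

lemma corr_nonneg: "p \<in> {0..1} \<Longrightarrow> 0 \<le> corr p"
  by (simp add: corr_def)

lemma corr_le:
  assumes "p \<in> {0..1}"
  shows "corr p \<le> p / 4"
proof -
  have "4 * (1 - p) \<le> (2 - p)\<^sup>2" by (simp add: power2_eq_square algebra_simps)
  then have "p * (4 * (1 - p)) \<le> p * (2 - p)\<^sup>2" using assms by (intro mult_left_mono) auto
  then show ?thesis using assms by (simp add: corr_def field_simps)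
qed

lemma rate_pos: "p \<in> {0..1} \<Longrightarrow> 0 < rate p"
  by (simp add: rate_def)

lemma one_minus_half_le_rate: "p \<in> {0..1} \<Longrightarrow> 1 - p / 2 \<le> rate p"
  using corr_nonneg[of p] by (simp add: rate_def mult_le_cancel_left1)

text \<open>This is what makes the products of a main term, on \<open>n - 1\<close> pairs, with an error term, on about
  \<open>2 n\<close> pairs, negligible against \<open>q ^ (2 n)\<close>. After division by \<open>q\<^sup>2\<close> it reads
  \<open>q exp (3 \<theta> / 2) < 1\<close>, which follows from \<open>q \<le> exp (- p / 2)\<close> and \<open>\<theta> \<le> p / 4\<close>.\<close>

lemma rate_cube_less:
  assumes "0 < p" "p \<le> 1"
  shows "rate p ^ 3 < (1 - p / 2)\<^sup>2"
proof -
  have q: "0 < 1 - p / 2" using assms by simp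
  have "(1 - p / 2) * exp (3 * corr p / 2) \<le> exp (- p / 2) * exp (3 * corr p / 2)"
    using exp_ge_add_one_self[of "- p / 2"] by (intro mult_right_mono) auto
  also have "\<dots> = exp (- p / 2 + 3 * corr p / 2)" by (simp only: exp_add)
  also have "\<dots> < exp 0"
    using corr_le[of p] assms by (subst exp_less_cancel_iff) auto
  finally have "(1 - p / 2)\<^sup>2 * ((1 - p / 2) * exp (3 * corr p / 2)) < (1 - p / 2)\<^sup>2 * 1"
    using q by (intro mult_strict_left_mono) auto
  moreover have "rate p ^ 3 = (1 - p / 2)\<^sup>2 * ((1 - p / 2) * exp (3 * corr p / 2))"
    unfolding rate_def power_mult_distrib exp_of_nat_mult[symmetric]
    by (simp add: power3_eq_cube power2_eq_square)
  ultimately show ?thesis by simp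
qed

lemma rate_less_one:
  assumes "0 < p" "p \<le> 1"
  shows "rate p < 1"
proof (rule ccontr)
  assume "\<not> rate p < 1"
  then have "1 \<le> rate p ^ 3" by (intro one_le_power) auto
  moreover have "(1 - p / 2)\<^sup>2 \<le> 1" using assms by (intro power_le_one) auto
  ultimately show False using rate_cube_less[OF assms] by simp
qed

definition pair_moment :: "nat \<Rightarrow> real \<Rightarrow> nat \<Rightarrow> nat \<Rightarrow> real" where
  "pair_moment n p k j = (1 - p / 2) ^ (k + j) * hypergeom_gf (n choose 2) k j (corr p)"

text \<open>For \<open>k, j \<le> N\<close> one has \<open>k j / N \<le> (k + j) / 2\<close>, so the correlation costs at most a factor
  \<open>exp (\<theta> / 2)\<close> for each pair.\<close>

lemma pair_moment_le:
  assumes "p \<in> {0..1}" "k \<le> n choose 2" "j \<le> n choose 2"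
  shows "pair_moment n p k j \<le> rate p ^ (k + j)"
proof -
  let ?N = "n choose 2"
  have "2 * (real k * real j) \<le> real ?N * (real k + real j)"
  proof -
    have "real k * real j \<le> real ?N * real j" "real k * real j \<le> real k * real ?N"
      using assms by (auto intro: mult_right_mono mult_left_mono)
    then show ?thesis by (simp add: algebra_simps)
  qed
  then have kj: "real k * real j / real ?N \<le> (real k + real j) / 2"
    by (cases "?N = 0") (simp_all del: binomial_eq_0_iff add: field_simps)
  have "hypergeom_gf ?N k j (corr p) \<le> exp (corr p * real k * real j / real ?N)"
    using assms corr_nonneg by (intro hypergeom_gf_le_exp) auto
  also have "\<dots> \<le> exp (corr p * ((real k + real j) / 2))"
    using mult_left_mono[OF kj corr_nonneg[OF assms(1)]] by (simp add: mult.assoc)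
  also have "\<dots> = exp (corr p / 2) ^ (k + j)"
    by (simp add: exp_of_nat_mult[symmetric] mult.commute)
  finally show ?thesis
    using assms by (simp add: pair_moment_def rate_def power_mult_distrib mult_left_mono)
qed

section \<open>First and second moments for a missing path\<close>

definition cut_size :: "nat \<Rightarrow> nat set \<Rightarrow> nat" where
  "cut_size n S = card S * (n - card S)"

definition mid_separators :: "nat \<Rightarrow> nat \<Rightarrow> nat \<Rightarrow> nat set set" where
  "mid_separators n u v = {S \<in> separators n u v. 2 \<le> card S \<and> card S + 2 \<le> n}"

text \<open>The separators with a single vertex on one side are just \<open>{u}\<close> and the complement of \<open>{v}\<close>. For
  \<open>n = 2\<close> these two would coincide.\<close>

lemma sum_separators:
  fixes f :: "nat set \<Rightarrow> real"
  assumes "3 \<le> n" "u < n" "v < n" "u \<noteq> v"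
  shows "(\<Sum>S\<in>separators n u v. f S) =
    f {u} + f ({..<n} - {v}) + (\<Sum>S\<in>mid_separators n u v. f S)"
proof -
  have fin: "finite S" if "S \<in> separators n u v" for S
    using that finite_subset by (auto simp: separators_def)
  have cV: "card ({..<n} - {v}) = n - 1" using assms by simp
  have ends: "S = {u} \<or> S = {..<n} - {v}"
    if S: "S \<in> separators n u v" "S \<notin> mid_separators n u v" for S
  proof -
    have sub: "{u} \<subseteq> S" "S \<subseteq> {..<n} - {v}" "S \<noteq> {}"
      using S(1) by (auto simp: separators_def)
    have "card S < 2 \<or> n - 1 \<le> card S" using S by (auto simp: mid_separators_def)
    moreover have "card S \<noteq> 0" using sub fin[OF S(1)] by auto
    ultimately have "card S \<le> card {u} \<or> card ({..<n} - {v}) \<le> card S"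
      unfolding cV by (simp; linarith)
    then show ?thesis
      using sub fin[OF S(1)] card_seteq[of S "{u}"] card_seteq[of "{..<n} - {v}" S] by auto
  qed
  have mem: "{u} \<in> separators n u v" "{..<n} - {v} \<in> separators n u v"
    using assms by (auto simp: separators_def)
  have notmid: "{u} \<notin> mid_separators n u v" "{..<n} - {v} \<notin> mid_separators n u v"
    using assms cV by (auto simp: mid_separators_def)
  have "card {u} \<noteq> card ({..<n} - {v})" using assms(1) cV by simp
  then have neq: "{u} \<noteq> {..<n} - {v}" by metis
  have "separators n u v = insert {u} (insert ({..<n} - {v}) (mid_separators n u v))"
    using mem ends by (auto simp: mid_separators_def)
  moreover have "finite (mid_separators n u v)"
    by (simp add: mid_separators_def)
  ultimately show ?thesis using neq notmid by simp
qed

lemma sum_mid_separators_le: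
  assumes "0 \<le> x"
  shows "(\<Sum>S\<in>mid_separators n u v. x ^ cut_size n S) \<le> cut_sum 2 n x"
  unfolding cut_sum_def cut_size_def
  by (rule sum_mono2) (use assms in \<open>auto simp: mid_separators_def separators_def\<close>)

lemma cut_size_le: "S \<in> separators n u v \<Longrightarrow> cut_size n S \<le> n choose 2"
  using card_one_way_le[OF one_way_cut_arcs, of S n] card_cut_arcs[of S n]
  by (simp add: separators_def cut_size_def)

lemma cut_size_ends:
  assumes "u < n"
  shows "cut_size n {u} = n - 1" "cut_size n ({..<n} - {u}) = n - 1"
  using assms by (auto simp: cut_size_def)

abbreviation end_cuts :: "nat \<Rightarrow> nat \<Rightarrow> nat \<Rightarrow> (nat \<times> nat) set" where
  "end_cuts n u v \<equiv> cut_arcs n {u} \<union> cut_arcs n ({..<n} - {v})"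

lemma one_way_end_cuts:
  assumes "u < n" "v < n" "u \<noteq> v"
  shows "one_way n (end_cuts n u v)"
    and "card (end_cuts n u v) = 2 * n - 3"
proof -
  let ?U = "cut_arcs n {u}" and ?V = "cut_arcs n ({..<n} - {v})"
  show "one_way n (?U \<union> ?V)"
    using assms by (auto simp: one_way_def cut_arcs_def)
  have fin: "finite ?U" "finite ?V" by (auto simp: cut_arcs_def)
  have "?U \<inter> ?V = {(u, v)}" using assms by (auto simp: cut_arcs_def)
  then have "card ?U + card ?V = card (?U \<union> ?V) + 1"
    using card_Un_Int[OF fin] by simp
  moreover have "card ?U = n - 1" "card ?V = n - 1"
    using card_cut_arcs[of "{u}" n] card_cut_arcs[of "{..<n} - {v}" n] assms by auto
  ultimately show "card (?U \<union> ?V) = 2 * n - 3" by simp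
qed

lemma avoid_Un: "avoid (F \<union> G) = avoid F \<inter> avoid G"
  by (auto simp: avoid_def)

lemma avoid_end_cuts_no_path:
  assumes "\<omega> \<in> set_pmf (oriented_gnp n p)" "u < n" "v < n" "u \<noteq> v"
    "\<omega> \<in> avoid (cut_arcs n {u}) \<union> avoid (cut_arcs n ({..<n} - {v}))"
  shows "\<omega> \<in> no_path u v"
proof -
  have "{u} \<in> separators n u v" "{..<n} - {v} \<in> separators n u v"
    using assms by (auto simp: separators_def)
  then show ?thesis using no_path_iff_avoid_cut'[OF assms(1,2)] assms(5) by blast
qed

text \<open>The total weight, measured by \<open>rate p\<close>, of all that has to be neglected: the cuts with two or more
  vertices on either side, and the overlap of the two main cuts, which together have \<open>2 n - 3\<close> arcs.\<close>

definition cut_error :: "nat \<Rightarrow> real \<Rightarrow> real" where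
  "cut_error n p = cut_sum 2 n (rate p) + rate p ^ (2 * n - 3)"

lemma prob_no_path_approx:
  assumes p: "p \<in> {0..1}" and n: "3 \<le> n" and uv: "u < n" "v < n" "u \<noteq> v"
  shows "\<bar>measure (oriented_gnp n p) (no_path u v) - 2 * (1 - p / 2) ^ (n - 1)\<bar> \<le> cut_error n p"
proof -
  let ?P = "oriented_gnp n p" and ?q = "1 - p / 2"
  have q: "0 \<le> ?q" "?q \<le> rate p" using p one_minus_half_le_rate[OF p] by auto
  have cut: "measure ?P (avoid (cut_arcs n S)) = ?q ^ cut_size n S" if "S \<subseteq> {..<n}" for S
    using prob_avoid_one_way[OF p one_way_cut_arcs[OF that]] card_cut_arcs[OF that]
    by (simp add: cut_size_def)
  have "measure ?P (no_path u v) \<le> (\<Sum>S\<in>separators n u v. measure ?P (avoid (cut_arcs n S)))"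
    by (rule prob_le_sum) (use no_path_iff_avoid_cut' uv in auto)
  also have "\<dots> = (\<Sum>S\<in>separators n u v. ?q ^ cut_size n S)"
    by (intro sum.cong refl cut) (auto simp: separators_def)
  also have "\<dots> = 2 * ?q ^ (n - 1) + (\<Sum>S\<in>mid_separators n u v. ?q ^ cut_size n S)"
    using uv by (simp add: sum_separators[OF n uv] cut_size_ends)
  also have "\<dots> \<le> 2 * ?q ^ (n - 1) + cut_sum 2 n (rate p)"
    using sum_mid_separators_le[OF q(1), of n u v] cut_sum_mono[OF q, of 2 n] by simp
  finally have upper: "measure ?P (no_path u v) \<le> 2 * ?q ^ (n - 1) + cut_sum 2 n (rate p)" .
  let ?F = "end_cuts n u v"
  have "measure ?P (avoid ?F) = ?q ^ (2 * n - 3)"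
    using prob_avoid_one_way[OF p one_way_end_cuts(1)[OF uv]] one_way_end_cuts(2)[OF uv] by simp
  moreover have "measure ?P (avoid (cut_arcs n {u})) + measure ?P (avoid (cut_arcs n ({..<n} - {v})))
      - measure ?P (avoid (cut_arcs n {u}) \<inter> avoid (cut_arcs n ({..<n} - {v})))
      \<le> measure ?P (no_path u v)"
    by (rule prob_ge_two) (use avoid_end_cuts_no_path uv in blast)
  ultimately have lower: "2 * ?q ^ (n - 1) - ?q ^ (2 * n - 3) \<le> measure ?P (no_path u v)"
    using uv by (simp add: cut cut_size_ends avoid_Un)
  have "?q ^ (2 * n - 3) \<le> rate p ^ (2 * n - 3)" using q by (intro power_mono) auto
  moreover have "0 \<le> cut_sum 2 n (rate p)" "0 \<le> rate p ^ (2 * n - 3)"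
    using q by (auto intro: cut_sum_nonneg)
  ultimately show ?thesis using upper lower by (simp add: cut_error_def abs_le_iff)
qed

text \<open>Both conditional probabilities lie between a sum of two main terms minus an overlap and a sum over
  all separating cuts. Multiplying the bounds out, every product of two terms is the conditional
  probability of avoiding one arc set times that of avoiding another, whose mean is known exactly; the
  four products of main terms all have mean \<open>pair_moment n p (n - 1) (n - 1)\<close>.\<close>

lemma product_moment_no_path_approx:
  assumes p: "p \<in> {0..1}" and n: "3 \<le> n"
    and uv: "u < n" "v < n" "u \<noteq> v" and wz: "w < n" "z < n" "w \<noteq> z"
  shows "\<bar>measure_pmf.expectation (oriented_gnp n p)
      (\<lambda>\<omega>. prob_given (oriented_gnp n p) (no_path u v) num_edges \<omega> *
           prob_given (oriented_gnp n p) (no_path w z) num_edges \<omega>) -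
      4 * pair_moment n p (n - 1) (n - 1)\<bar>
    \<le> 4 * rate p ^ (n - 1) * cut_error n p + (cut_error n p)\<^sup>2"
proof -
  let ?P = "oriented_gnp n p" and ?r = "rate p"
  define E where "E f = measure_pmf.expectation ?P f" for f :: "_ \<Rightarrow> real"
  define X where "X A = prob_given ?P A num_edges" for A
  define Y where "Y F = X (avoid F)" for F
  define m where "m = pair_moment n p"
  define C where "C = cut_sum 2 n ?r"
  define R where "R = ?r ^ (2 * n - 3)"
  define x where "x = ?r ^ (n - 1)"
  have r: "0 < ?r" by (rule rate_pos[OF p])
  have nonneg: "0 \<le> C" "0 \<le> R" "0 \<le> x"
    using r by (auto simp: C_def R_def x_def intro: cut_sum_nonneg)
  have E_mono: "E f \<le> E g" if "\<And>\<omega>. f \<omega> \<le> g \<omega>" for f g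
    unfolding E_def using that by (intro integral_mono) auto
  have E_Y: "E (\<lambda>\<omega>. Y F \<omega> * Y G \<omega>) = m (card F) (card G)" if "one_way n F" "one_way n G" for F G
    using expectation_prob_given_avoid_mult[OF p that]
    by (simp add: E_def Y_def X_def m_def pair_moment_def corr_def)
  define y where "y S = Y (cut_arcs n S)" for S
  have E_y: "E (\<lambda>\<omega>. y S \<omega> * y T \<omega>) = m (cut_size n S) (cut_size n T)"
    if "S \<in> separators n u v" "T \<in> separators n w z" for S T
    using that E_Y[OF one_way_cut_arcs one_way_cut_arcs, of S T]
    by (simp add: y_def separators_def card_cut_arcs cut_size_def)
  have X_nonneg: "0 \<le> X A \<omega>" for A \<omega> by (simp add: X_def prob_given_nonneg)
  have le_sum: "X (no_path u v) \<omega> \<le> (\<Sum>S\<in>separators n u v. y S \<omega>)" if "u < n" for u v \<omega>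
    unfolding X_def y_def Y_def
    by (rule prob_given_le_sum) (use no_path_iff_avoid_cut' that in auto)
  have upper: "E (\<lambda>\<omega>. X (no_path u v) \<omega> * X (no_path w z) \<omega>) \<le> 4 * m (n - 1) (n - 1) + 4 * x * C + C\<^sup>2"
  proof -
    have mid: "m (cut_size n S) (cut_size n T) \<le> ?r ^ cut_size n S * ?r ^ cut_size n T"
      if "S \<in> separators n u v" "T \<in> separators n w z" for S T
      unfolding m_def power_add[symmetric]
      using that by (intro pair_moment_le p cut_size_le) auto
    have mem: "{u} \<in> separators n u v" "{..<n} - {v} \<in> separators n u v"
        "{w} \<in> separators n w z" "{..<n} - {z} \<in> separators n w z"
      using uv wz by (auto simp: separators_def)
    have "E (\<lambda>\<omega>. X (no_path u v) \<omega> * X (no_path w z) \<omega>) \<le>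
        E (\<lambda>\<omega>. (\<Sum>S\<in>separators n u v. y S \<omega>) * (\<Sum>T\<in>separators n w z. y T \<omega>))"
      using uv wz by (intro E_mono mult_mono le_sum sum_nonneg)
        (auto simp: y_def Y_def X_nonneg)
    also have "\<dots> = (\<Sum>S\<in>separators n u v. \<Sum>T\<in>separators n w z. E (\<lambda>\<omega>. y S \<omega> * y T \<omega>))"
      unfolding sum_product E_def
      by (subst Bochner_Integration.integral_sum; simp)
    also have "\<dots> = (\<Sum>S\<in>separators n u v. \<Sum>T\<in>separators n w z. m (cut_size n S) (cut_size n T))"
      by (intro sum.cong refl E_y)
    also have "\<dots> \<le> 4 * m (n - 1) (n - 1) + 4 * x * C + C\<^sup>2"
    proof -
      have row: "(\<Sum>T\<in>separators n w z. m (cut_size n S) (cut_size n T)) \<le>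
          2 * m (cut_size n S) (n - 1) + ?r ^ cut_size n S * C"
        if S: "S \<in> separators n u v" for S
      proof -
        have "(\<Sum>T\<in>mid_separators n w z. m (cut_size n S) (cut_size n T)) \<le>
            (\<Sum>T\<in>mid_separators n w z. ?r ^ cut_size n S * ?r ^ cut_size n T)"
          using S by (intro sum_mono mid) (auto simp: mid_separators_def)
        also have "\<dots> \<le> ?r ^ cut_size n S * C"
          unfolding sum_distrib_left[symmetric] C_def
          using r by (intro mult_left_mono sum_mid_separators_le) auto
        finally show ?thesis
          using wz by (simp add: sum_separators[OF n wz] cut_size_ends)
      qed
      have "(\<Sum>S\<in>mid_separators n u v. \<Sum>T\<in>separators n w z. m (cut_size n S) (cut_size n T)) \<le>
          (\<Sum>S\<in>mid_separators n u v. ?r ^ cut_size n S * (2 * x + C))"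
      proof (rule sum_mono)
        fix S assume "S \<in> mid_separators n u v"
        then have S: "S \<in> separators n u v" by (simp add: mid_separators_def)
        have "m (cut_size n S) (n - 1) \<le> ?r ^ cut_size n S * x"
          using mid[OF S mem(3)] wz by (simp add: cut_size_ends x_def)
        then show "(\<Sum>T\<in>separators n w z. m (cut_size n S) (cut_size n T)) \<le>
            ?r ^ cut_size n S * (2 * x + C)"
          using row[OF S] by (simp add: algebra_simps)
      qed
      also have "\<dots> \<le> C * (2 * x + C)"
        unfolding sum_distrib_right[symmetric] C_def
        using r nonneg by (intro mult_right_mono sum_mid_separators_le) (auto simp: C_def)
      finally show ?thesis
        using row[OF mem(1)] row[OF mem(2)] uv
        by (simp add: sum_separators[OF n uv] cut_size_ends x_def
            power2_eq_square algebra_simps)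
    qed
    finally show ?thesis .
  qed
  \<comment> \<open>The lower bounds \<open>s - d\<close> may be multiplied because they are nonnegative: the overlap \<open>d\<close> is
    bounded by either of the two main terms in \<open>s\<close>.\<close>
  have lower: "4 * m (n - 1) (n - 1) - 4 * x * R \<le>
      E (\<lambda>\<omega>. X (no_path u v) \<omega> * X (no_path w z) \<omega>)"
  proof -
    define s where "s u v \<omega> = y {u} \<omega> + y ({..<n} - {v}) \<omega>" for u v \<omega>
    define d where "d u v \<omega> = Y (end_cuts n u v) \<omega>" for u v \<omega>
    have s_nonneg: "0 \<le> s u v \<omega>" for u v \<omega>
      by (simp add: s_def y_def Y_def X_nonneg)
    have d_nonneg: "0 \<le> d u v \<omega>" for u v \<omega>
      by (simp add: d_def Y_def X_nonneg)
    have d_le: "d u v \<omega> \<le> s u v \<omega>" for u v \<omega>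
    proof -
      have "d u v \<omega> \<le> y {u} \<omega>"
        unfolding d_def y_def Y_def X_def by (rule prob_given_mono) (auto simp: avoid_def)
      then show ?thesis using X_nonneg by (simp add: s_def y_def Y_def add_increasing2)
    qed
    have ge: "s u v \<omega> - d u v \<omega> \<le> X (no_path u v) \<omega>" if "u < n" "v < n" "u \<noteq> v" for u v \<omega>
      unfolding s_def d_def y_def Y_def X_def avoid_Un
      by (rule prob_given_ge_two) (use avoid_end_cuts_no_path that in blast)
    have "s u v \<omega> * s w z \<omega> - d u v \<omega> * s w z \<omega> - s u v \<omega> * d w z \<omega> \<le>
        X (no_path u v) \<omega> * X (no_path w z) \<omega>" for \<omega>
    proof -
      have "(s u v \<omega> - d u v \<omega>) * (s w z \<omega> - d w z \<omega>) \<le> X (no_path u v) \<omega> * X (no_path w z) \<omega>"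
        using ge uv wz d_le X_nonneg by (intro mult_mono) auto
      moreover have "0 \<le> d u v \<omega> * d w z \<omega>" using d_nonneg by simp
      ultimately show ?thesis by (simp add: algebra_simps)
    qed
    then have "E (\<lambda>\<omega>. s u v \<omega> * s w z \<omega> - d u v \<omega> * s w z \<omega> - s u v \<omega> * d w z \<omega>) \<le>
        E (\<lambda>\<omega>. X (no_path u v) \<omega> * X (no_path w z) \<omega>)"
      by (rule E_mono)
    moreover have "E (\<lambda>\<omega>. s u v \<omega> * s w z \<omega> - d u v \<omega> * s w z \<omega> - s u v \<omega> * d w z \<omega>) =
        4 * m (n - 1) (n - 1) - 2 * m (2 * n - 3) (n - 1) - 2 * m (n - 1) (2 * n - 3)"
    proof -
      have ow: "one_way n (cut_arcs n {t})" "one_way n (cut_arcs n ({..<n} - {t}))"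
        and c: "card (cut_arcs n {t}) = n - 1" "card (cut_arcs n ({..<n} - {t})) = n - 1"
        if "t < n" for t
        using that card_cut_arcs[of "{t}" n] card_cut_arcs[of "{..<n} - {t}" n]
        by (auto intro: one_way_cut_arcs)
      have "m k j = m j k" for k j
        by (simp add: m_def pair_moment_def hypergeom_gf_commute[of _ k] add.commute)
      note m_commute = this[of "2 * n - 3" "n - 1"]
      note E_Ys = E_Y[unfolded E_def]
      show ?thesis
        unfolding s_def d_def y_def E_def
        using uv wz m_commute
        by (simp add: algebra_simps E_Ys ow c one_way_end_cuts)
    qed
    moreover have "m (2 * n - 3) (n - 1) \<le> R * x" "m (n - 1) (2 * n - 3) \<le> x * R"
    proof -
      have N: "2 * n - 3 \<le> n choose 2" "n - 1 \<le> n choose 2"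
        using card_one_way_le[OF one_way_end_cuts(1)[OF uv]] one_way_end_cuts(2)[OF uv] n by auto
      show "m (2 * n - 3) (n - 1) \<le> R * x" "m (n - 1) (2 * n - 3) \<le> x * R"
        using pair_moment_le[OF p N] pair_moment_le[OF p N(2,1)]
        by (auto simp: m_def R_def x_def power_add)
    qed
    ultimately show ?thesis by (simp add: mult_ac)
  qed
  have "0 \<le> 4 * x * R" "0 \<le> 4 * x * C" "C\<^sup>2 \<le> (C + R)\<^sup>2"
    using nonneg by (auto intro: power_mono)
  moreover have "4 * x * (C + R) = 4 * x * C + 4 * x * R" by (rule distrib_left)
  ultimately have "\<bar>E (\<lambda>\<omega>. X (no_path u v) \<omega> * X (no_path w z) \<omega>) - 4 * m (n - 1) (n - 1)\<bar>
      \<le> 4 * x * (C + R) + (C + R)\<^sup>2"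
    using upper lower zero_le_power2[of "C + R"] by linarith
  then show ?thesis
    by (simp add: E_def X_def m_def C_def R_def x_def cut_error_def)
qed

section \<open>Two missing paths\<close>

text \<open>For \<open>D \<subseteq> Q\<close>: avoiding this set means that in relation to the vertices outside \<open>Q\<close>, those in \<open>D\<close>
  have no outgoing arcs and those in \<open>Q - D\<close> no incoming ones.\<close>

definition star_arcs :: "nat \<Rightarrow> nat set \<Rightarrow> nat set \<Rightarrow> (nat \<times> nat) set" where
  "star_arcs n Q D = D \<times> ({..<n} - Q) \<union> ({..<n} - Q) \<times> (Q - D)"

text \<open>Avoiding this set means that \<open>v\<close> has no neighbours except possibly \<open>w\<close>. For \<open>w = v\<close> no exception
  is made.\<close>

definition isolating_arcs :: "nat \<Rightarrow> nat \<Rightarrow> nat \<Rightarrow> (nat \<times> nat) set" where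
  "isolating_arcs n v w = {v} \<times> ({..<n} - {v, w}) \<union> ({..<n} - {v, w}) \<times> {v}"

lemma avoid_antimono: "F \<subseteq> G \<Longrightarrow> avoid G \<subseteq> avoid F"
  by (auto simp: avoid_def)

lemma one_way_star_arcs: "D \<subseteq> Q \<Longrightarrow> Q \<subseteq> {..<n} \<Longrightarrow> one_way n (star_arcs n Q D)"
  by (auto simp: one_way_def star_arcs_def)

lemma card_star_arcs:
  assumes "D \<subseteq> Q" "Q \<subseteq> {..<n}"
  shows "card (star_arcs n Q D) = card Q * (n - card Q)"
proof -
  have fin: "finite Q" using assms(2) finite_subset by blast
  moreover from fin have "finite D" using assms(1) finite_subset by blast
  ultimately have "card (star_arcs n Q D) = card D * (n - card Q) + (n - card Q) * (card Q - card D)"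
    unfolding star_arcs_def
    by (subst card_Un_disjoint) (use assms in \<open>auto simp: card_Diff_subset\<close>)
  also have "\<dots> = (card D + (card Q - card D)) * (n - card Q)"
    by (simp only: add_mult_distrib mult.commute[of "n - card Q"])
  finally show ?thesis using card_mono[OF fin assms(1)] by simp
qed

lemma prob_avoid_star_arcs:
  assumes "p \<in> {0..1}" "D \<subseteq> Q" "Q \<subseteq> {..<n}"
  shows "measure (oriented_gnp n p) (avoid (star_arcs n Q D)) = (1 - p / 2) ^ (card Q * (n - card Q))"
  using prob_avoid_one_way[OF assms(1) one_way_star_arcs[OF assms(2,3)]] card_star_arcs[OF assms(2,3)]
  by simp

text \<open>Here both arcs are forbidden on each of at least \<open>n - 2\<close> pairs, so these pairs must not be edges.\<close>

lemma prob_avoid_isolating_arcs: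
  assumes p: "p \<in> {0..1}" and "v < n"
  shows "measure (oriented_gnp n p) (avoid (isolating_arcs n v w)) \<le> (1 - p) ^ (n - 2)"
proof -
  let ?U = "{..<n} - {v, w}"
  define K where "K = (\<lambda>u. {v, u}) ` ?U"
  have K: "K \<subseteq> vertex_pairs n"
    using assms(2) by (auto simp: K_def vertex_pairs_def card_insert_if)
  have "card K = card ?U"
    unfolding K_def by (intro card_image) (auto simp: inj_on_def doubleton_eq_iff)
  moreover have "n - 2 \<le> card ?U"
  proof -
    have "card {..<n} - card {v, w} \<le> card ?U" by (rule diff_card_le_card_Diff) simp
    moreover have "card {v, w} \<le> 2" by (simp add: card_insert_if)
    ultimately show ?thesis by simp
  qed
  ultimately have cK: "n - 2 \<le> card K" by simp
  have "measure (oriented_gnp n p) (avoid (isolating_arcs n v w)) \<le>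
      (\<Prod>e\<in>vertex_pairs n. if e \<in> K then 1 - p else 1)"
    unfolding prob_avoid[OF p]
  proof (rule prod_mono, intro conjI)
    fix e assume e: "e \<in> vertex_pairs n"
    let ?c = "card (arcs e \<inter> isolating_arcs n v w)"
    have "?c \<le> card (arcs e)" using finite_arcs[OF e] by (intro card_mono) auto
    then have "real ?c \<le> 2" using card_arcs[OF e] by simp
    then have "p * real ?c \<le> 1 * 2" using p by (intro mult_mono) auto
    then show "0 \<le> 1 - p * real ?c / 2" by simp
    show "1 - p * real ?c / 2 \<le> (if e \<in> K then 1 - p else 1)"
    proof (cases "e \<in> K")
      case True
      then obtain u where u: "e = {v, u}" "u \<in> ?U" by (auto simp: K_def)
      then have "arcs e = {(v, u), (u, v)}" using arcs_doubleton[of v u] by auto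
      then have "arcs e \<inter> isolating_arcs n v w = arcs e"
        using u(2) assms(2) by (simp add: isolating_arcs_def)
      then show ?thesis using card_arcs[OF e] True by simp
    qed (use p in simp)
  qed
  also have "\<dots> = (1 - p) ^ card K"
    by (rule prod_if_mem_eq_power[OF finite_vertex_pairs K])
  also have "\<dots> \<le> (1 - p) ^ (n - 2)"
    using cK p by (intro power_decreasing) auto
  finally show ?thesis .
qed

text \<open>These two arc sets and \<open>end_cuts n a b\<close> are the main configurations for \<open>\<not> a \<rightarrow> s\<close> and \<open>\<not> s \<rightarrow> b\<close>. They
  correspond to the chains of cuts with one vertex in two of the three classes before, between and
  behind the cuts, and each of them has \<open>2 n - 3\<close> arcs.\<close>

definition source_cuts :: "nat \<Rightarrow> nat \<Rightarrow> nat \<Rightarrow> (nat \<times> nat) set" where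
  "source_cuts n a s = cut_arcs n {a} \<union> cut_arcs n {a, s}"

definition target_cuts :: "nat \<Rightarrow> nat \<Rightarrow> nat \<Rightarrow> (nat \<times> nat) set" where
  "target_cuts n s b = cut_arcs n ({..<n} - {b}) \<union> cut_arcs n ({..<n} - {s, b})"

lemma one_way_source_cuts:
  assumes "a < n" "s < n" "a \<noteq> s"
  shows "one_way n (source_cuts n a s)" "card (source_cuts n a s) = 2 * n - 3"
proof -
  show "one_way n (source_cuts n a s)"
    using assms by (auto simp: one_way_def cut_arcs_def source_cuts_def)
  have "source_cuts n a s = {a} \<times> ({..<n} - {a}) \<union> {s} \<times> ({..<n} - {a, s})"
    by (auto simp: source_cuts_def cut_arcs_def)
  also have "card \<dots> = (n - 1) + (n - 2)"
    by (subst card_Un_disjoint) (use assms in auto)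
  finally show "card (source_cuts n a s) = 2 * n - 3" using assms by simp
qed

lemma one_way_target_cuts:
  assumes "s < n" "b < n" "s \<noteq> b"
  shows "one_way n (target_cuts n s b)" "card (target_cuts n s b) = 2 * n - 3"
proof -
  show "one_way n (target_cuts n s b)"
    using assms by (auto simp: one_way_def cut_arcs_def target_cuts_def)
  have "target_cuts n s b = ({..<n} - {b}) \<times> {b} \<union> ({..<n} - {s, b}) \<times> {s}"
    using assms by (auto simp: target_cuts_def cut_arcs_def)
  also have "card \<dots> = (n - 1) + (n - 2)"
    by (subst card_Un_disjoint) (use assms in auto)
  finally show "card (target_cuts n s b) = 2 * n - 3" using assms by simp
qed

text \<open>Let \<open>S\<close> separate \<open>a\<close> from \<open>s\<close> and \<open>T\<close> separate \<open>s\<close> from \<open>b\<close>, each with at most two vertices on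
  its smaller side, and let \<open>Q\<close> be the union of the two smaller sides. Every vertex of \<open>Q\<close> has no arcs to,
  or no arcs from, the vertices outside \<open>Q\<close>. If \<open>Q\<close> has three or four vertices, this is one of the
  unlikely events of the fourth alternative. Otherwise \<open>Q\<close> consists of at most two vertices, which are
  determined up to one by which of \<open>a\<close>, \<open>s\<close>, \<open>b\<close> it must contain. Then either the cuts form one of the
  three main configurations, or a vertex lies on the smaller sides of both cuts in opposite directions
  and is adjacent to at most one other vertex.\<close>

lemma two_cuts_cases:
  assumes D: "snd \<omega> \<subseteq> {..<n} \<times> {..<n}"
    and abs: "a < n" "s < n" "b < n" "distinct [a, s, b]"
    and S: "S \<in> separators n a s" "\<omega> \<in> avoid (cut_arcs n S)"
    and T: "T \<in> separators n s b" "\<omega> \<in> avoid (cut_arcs n T)"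
    and small: "card S \<le> 2 \<or> n \<le> card S + 2" "card T \<le> 2 \<or> n \<le> card T + 2"
  shows "\<omega> \<in> avoid (source_cuts n a s) \<or> \<omega> \<in> avoid (target_cuts n s b) \<or>
    \<omega> \<in> avoid (end_cuts n a b) \<or>
    (\<exists>Q D. D \<subseteq> Q \<and> Q \<subseteq> {..<n} \<and> card Q \<in> {3, 4} \<and> \<omega> \<in> avoid (star_arcs n Q D)) \<or>
    (\<exists>v<n. \<exists>w<n. \<omega> \<in> avoid (isolating_arcs n v w))"
    (is "?M1 \<or> ?M2 \<or> ?M3 \<or> ?star \<or> ?iso")
proof -
  let ?V = "{..<n}"
  have S': "S \<subseteq> ?V" "a \<in> S" "s \<notin> S" using S(1) by (auto simp: separators_def)
  have T': "T \<subseteq> ?V" "s \<in> T" "b \<notin> T" using T(1) by (auto simp: separators_def)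
  have fin: "finite S" "finite T" using S'(1) T'(1) finite_subset by blast+
  have S_closed: "(x, y) \<notin> snd \<omega>" if "x \<in> S" "y < n" "y \<notin> S" for x y
    using S(2) that by (auto simp: avoid_def cut_arcs_def)
  have T_closed: "(x, y) \<notin> snd \<omega>" if "x \<in> T" "y < n" "y \<notin> T" for x y
    using T(2) that by (auto simp: avoid_def cut_arcs_def)
  have avoidI: "\<omega> \<in> avoid F" if "\<And>x y. (x, y) \<in> F \<Longrightarrow> (x, y) \<notin> snd \<omega>" for F
    using that by (auto simp: avoid_def)
  have star: ?star
    if "D \<subseteq> A \<union> B" "A \<subseteq> ?V" "B \<subseteq> ?V" "card A \<le> 2" "card B \<le> 2" "\<not> card (A \<union> B) \<le> 2"
      "\<And>x y. x \<in> D \<Longrightarrow> y < n \<Longrightarrow> y \<notin> A \<Longrightarrow> y \<notin> B \<Longrightarrow> (x, y) \<notin> snd \<omega>"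
      "\<And>x y. x < n \<Longrightarrow> x \<notin> A \<Longrightarrow> x \<notin> B \<Longrightarrow> y \<in> A \<union> B \<Longrightarrow> y \<notin> D \<Longrightarrow> (x, y) \<notin> snd \<omega>"
    for A B D
  proof -
    have "card (A \<union> B) \<le> 4" using card_Un_le[of A B] that(4,5) by linarith
    then have "card (A \<union> B) \<in> {3, 4}" using that(6) by auto
    moreover have "\<omega> \<in> avoid (star_arcs n (A \<union> B) D)"
      by (rule avoidI) (auto simp: star_arcs_def that(7,8))
    moreover have "A \<union> B \<subseteq> ?V" using that(2,3) by simp
    ultimately show ?thesis using that(1) by blast
  qed
  have iso: ?iso
    if "v < n" "w < n" "\<And>x. x < n \<Longrightarrow> x \<noteq> v \<Longrightarrow> x \<noteq> w \<Longrightarrow> (v, x) \<notin> snd \<omega> \<and> (x, v) \<notin> snd \<omega>" for v w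
  proof -
    have "\<omega> \<in> avoid (isolating_arcs n v w)"
      by (rule avoidI) (auto simp: isolating_arcs_def dest: that(3))
    then show ?thesis using that by blast
  qed
  have pair: "x = u \<or> x = v" if "card (A \<union> B) \<le> 2" "A \<subseteq> ?V" "B \<subseteq> ?V" "u \<in> A \<union> B" "v \<in> A \<union> B"
      "u \<noteq> v" "x \<in> A \<union> B" for A B and u v x :: nat
  proof -
    have "finite (A \<union> B)" using that(2,3) finite_subset[of "A \<union> B" ?V] by simp
    then have "{u, v} = A \<union> B" using that(1,4-6) by (intro card_seteq) simp_all
    then show ?thesis using that(7) by blast
  qed
  have cS: "card (?V - S) = n - card S" and cT: "card (?V - T) = n - card T"
    using fin S'(1) T'(1) by (simp_all add: card_Diff_subset)
  consider (LL) "card S \<le> 2" "card T \<le> 2" | (LR) "card S \<le> 2" "card (?V - T) \<le> 2"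
    | (RL) "card (?V - S) \<le> 2" "card T \<le> 2" | (RR) "card (?V - S) \<le> 2" "card (?V - T) \<le> 2"
    using small cS cT by linarith
  then show ?thesis
  proof cases
    \<comment> \<open>\<open>L\<close> and \<open>R\<close> tell whether the smaller side of a cut is the closed set itself or its
      complement; the first letter is for \<open>S\<close>, the second for \<open>T\<close>.\<close>
    case LL
    show ?thesis
    proof (cases "card (S \<union> T) \<le> 2")
      case True
      have mem: "x = a \<or> x = s" if "x \<in> S \<or> x \<in> T" for x
        using pair[OF True S'(1) T'(1), of a s x] S' T' abs(4) that by simp
      have "(a, y) \<notin> snd \<omega>" if "y < n" "y \<noteq> a" for y
        using S_closed[OF S'(2) that(1)] mem[of y] S'(3) that by blast
      moreover have "(s, y) \<notin> snd \<omega>" if "y < n" "y \<noteq> a" "y \<noteq> s" for y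
        using T_closed[OF T'(2) that(1)] mem[of y] that by blast
      ultimately have ?M1
        by (intro avoidI) (auto simp: source_cuts_def cut_arcs_def)
      then show ?thesis by blast
    next
      case False
      have ?star
        by (rule star[of "S \<union> T" S T])
          (use LL False S'(1) T'(1) in \<open>auto dest: S_closed T_closed\<close>)
      then show ?thesis by blast
    qed
  next
    case LR
    show ?thesis
    proof (cases "card (S \<union> (?V - T)) \<le> 2")
      case True
      have mem: "x = a \<or> x = b" if "x \<in> S \<or> x < n \<and> x \<notin> T" for x
        using pair[OF True S'(1), of a b x] S' T' abs that by auto
      have out: "(x, y) \<notin> snd \<omega>" if "x \<in> S" "y < n" "y \<noteq> a" "y \<noteq> b" for x y
        using S_closed that mem by blast
      have inc: "(x, y) \<notin> snd \<omega>" if "y < n" "y \<notin> T" "x < n" "x \<noteq> a" "x \<noteq> b" for x y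
        using T_closed that mem by blast
      consider "b \<in> S" | "a \<notin> T" | "b \<notin> S" "a \<in> T" by blast
      then show ?thesis
      proof cases
        case 1
        have ?iso
          by (rule iso[OF abs(3,1)]) (use out[OF 1] inc[OF abs(3) T'(3)] in simp)
        then show ?thesis by blast
      next
        case 2
        have ?iso
          by (rule iso[OF abs(1,3)]) (use out[OF S'(2)] inc[OF abs(1) 2] in simp)
        then show ?thesis by blast
      next
        case 3
        have "(a, y) \<notin> snd \<omega>" if "y < n" "y \<noteq> a" for y
          using S_closed[OF S'(2) that(1)] mem[of y] 3 that by blast
        moreover have "(x, b) \<notin> snd \<omega>" if "x < n" "x \<noteq> b" for x
          using T_closed[OF _ abs(3) T'(3), of x] mem[of x] 3 that by blast
        ultimately have ?M3
          by (intro avoidI) (auto simp: cut_arcs_def)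
        then show ?thesis by blast
      qed
    next
      case False
      have ?star
        by (rule star[of S S "?V - T"])
          (use LR False S'(1) T'(1) in \<open>auto dest: S_closed T_closed\<close>)
      then show ?thesis by blast
    qed
  next
    case RL
    show ?thesis
    proof (cases "card ((?V - S) \<union> T) \<le> 2")
      case True
      have s_mem: "s \<in> (?V - S) \<union> T" using T'(2) by blast
      obtain w where w: "w < n" "\<And>x. x \<in> (?V - S) \<union> T \<Longrightarrow> x = s \<or> x = w"
      proof (cases "(?V - S) \<union> T \<subseteq> {s}")
        case False
        then obtain w where w: "w \<in> (?V - S) \<union> T" "w \<noteq> s" by blast
        then have "w < n" using T'(1) by auto
        then show ?thesis
          using pair[OF True _ T'(1) s_mem w(1)] w(2) that by blast
      qed (use that abs(2) in blast)
      have ?iso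
      proof (rule iso[OF abs(2) w(1)])
        fix x assume x: "x < n" "x \<noteq> s" "x \<noteq> w"
        then have "x \<in> S" "x \<notin> T" using w(2)[of x] by auto
        then show "(s, x) \<notin> snd \<omega> \<and> (x, s) \<notin> snd \<omega>"
          using S_closed[OF _ abs(2) S'(3)] T_closed[OF T'(2) x(1)] by blast
      qed
      then show ?thesis by blast
    next
      case False
      have ?star
        by (rule star[of T "?V - S" T])
          (use RL False S'(1) T'(1) in \<open>auto dest: S_closed T_closed\<close>)
      then show ?thesis by blast
    qed
  next
    case RR
    show ?thesis
    proof (cases "card ((?V - S) \<union> (?V - T)) \<le> 2")
      case True
      have mem: "x = s \<or> x = b" if "x < n" "x \<notin> S \<or> x \<notin> T" for x
        using pair[OF True, of s b x] S' T' abs that by auto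
      have "(x, b) \<notin> snd \<omega>" if "x < n" "x \<noteq> b" for x
        using T_closed[OF _ abs(3) T'(3), of x] mem[OF that(1)] T'(2) that by blast
      moreover have "(x, s) \<notin> snd \<omega>" if "x < n" "x \<noteq> b" "x \<noteq> s" for x
        using S_closed[OF _ abs(2) S'(3), of x] mem[OF that(1)] that by blast
      ultimately have ?M2
        by (intro avoidI) (auto simp: target_cuts_def cut_arcs_def)
      then show ?thesis by blast
    next
      case False
      have ?star
        by (rule star[of "{}" "?V - S" "?V - T"])
          (use RR False S'(1) T'(1) in \<open>auto dest: S_closed T_closed\<close>)
      then show ?thesis by blast
    qed
  qed
qed

text \<open>The union bounds for what is not one of the three main configurations: a cut with three or more
  vertices on either side, three or four vertices that are one-sided towards the rest, or a vertex
  without neighbours except possibly one.\<close>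

definition joint_error :: "nat \<Rightarrow> real \<Rightarrow> real" where
  "joint_error n p = 2 * cut_sum 3 n (1 - p / 2) + 32 * real n ^ 4 * (1 - p / 2) ^ (3 * (n - 3))
     + (real n)\<^sup>2 * (1 - p) ^ (n - 2)"

lemma card_three_or_four_subsets:
  assumes "4 \<le> n"
  shows "card {Q. Q \<subseteq> {..<n} \<and> card Q \<in> {3, 4}} \<le> 2 * n ^ 4"
proof -
  have "{Q. Q \<subseteq> {..<n} \<and> card Q \<in> {3, 4}} =
      {Q. Q \<subseteq> {..<n} \<and> card Q = 3} \<union> {Q. Q \<subseteq> {..<n} \<and> card Q = 4}" by auto
  then have "card {Q. Q \<subseteq> {..<n} \<and> card Q \<in> {3, 4}} \<le>
      card {Q. Q \<subseteq> {..<n} \<and> card Q = 3} + card {Q. Q \<subseteq> {..<n} \<and> card Q = 4}"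
    by (simp only: card_Un_le)
  also have "\<dots> = (n choose 3) + (n choose 4)"
    by (simp add: n_subsets)
  also have "\<dots> \<le> n ^ 3 + n ^ 4"
    using assms by (intro add_mono binomial_le_pow) simp_all
  also have "n ^ 3 \<le> n ^ 4"
    using assms by (intro power_increasing) simp_all
  finally show ?thesis by simp
qed

lemma sum_star_arcs_le:
  assumes p: "p \<in> {0..1}" and n: "7 \<le> n"
  shows "(\<Sum>(Q, D)\<in>Sigma {Q. Q \<subseteq> {..<n} \<and> card Q \<in> {3, 4}} Pow.
      measure (oriented_gnp n p) (avoid (star_arcs n Q D)))
    \<le> 32 * real n ^ 4 * (1 - p / 2) ^ (3 * (n - 3))"
proof -
  define q where "q = 1 - p / 2"
  define \<Q> where "\<Q> = {Q. Q \<subseteq> {..<n} \<and> card Q \<in> {3, 4}}"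
  have q: "0 \<le> q" "q \<le> 1" using p by (auto simp: q_def)
  have Q: "Q \<subseteq> {..<n}" "finite Q" "card Q = 3 \<or> card Q = 4" if "Q \<in> \<Q>" for Q
    using that finite_subset[of Q "{..<n}"] by (simp_all add: \<Q>_def)
  have "finite \<Q>" unfolding \<Q>_def by (rule finite_cuts)
  then have "(\<Sum>(Q, D)\<in>Sigma \<Q> Pow. measure (oriented_gnp n p) (avoid (star_arcs n Q D))) =
      (\<Sum>Q\<in>\<Q>. \<Sum>D\<in>Pow Q. measure (oriented_gnp n p) (avoid (star_arcs n Q D)))"
    by (rule sum.Sigma[symmetric]) (simp add: Q(2))
  also have "\<dots> \<le> (\<Sum>Q\<in>\<Q>. 16 * q ^ (3 * (n - 3)))"
  proof (rule sum_mono)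
    fix Q assume QQ: "Q \<in> \<Q>"
    have "(\<Sum>D\<in>Pow Q. measure (oriented_gnp n p) (avoid (star_arcs n Q D))) =
        (\<Sum>D\<in>Pow Q. q ^ (card Q * (n - card Q)))"
      using Q(1)[OF QQ] by (intro sum.cong refl) (simp add: prob_avoid_star_arcs[OF p] q_def)
    also have "\<dots> = 2 ^ card Q * q ^ (card Q * (n - card Q))"
      using Q(2)[OF QQ] by (simp add: card_Pow)
    also have "\<dots> \<le> 16 * q ^ (3 * (n - 3))"
    proof (rule mult_mono)
      show "(2::real) ^ card Q \<le> 16" using Q(3)[OF QQ] by (elim disjE) simp_all
      have "3 * (n - 3) \<le> card Q * (n - card Q)" using Q(3)[OF QQ] n by (elim disjE) simp_all
      then show "q ^ (card Q * (n - card Q)) \<le> q ^ (3 * (n - 3))"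
        using q by (rule power_decreasing)
    qed (use q in simp_all)
    finally show "(\<Sum>D\<in>Pow Q. measure (oriented_gnp n p) (avoid (star_arcs n Q D))) \<le>
        16 * q ^ (3 * (n - 3))" .
  qed
  also have "\<dots> = real (card \<Q>) * (16 * q ^ (3 * (n - 3)))" by simp
  also have "\<dots> \<le> real (2 * n ^ 4) * (16 * q ^ (3 * (n - 3)))"
    using card_three_or_four_subsets[of n] n q
    by (intro mult_right_mono) (simp_all only: of_nat_le_iff \<Q>_def, simp_all)
  finally show ?thesis by (simp add: q_def \<Q>_def)
qed

lemma prob_no_path_both_le:
  assumes p: "p \<in> {0..1}" and n: "7 \<le> n"
    and abs: "a < n" "s < n" "b < n" "distinct [a, s, b]"
  shows "measure (oriented_gnp n p) (no_path a s \<inter> no_path s b) \<le>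
    3 * (1 - p / 2) ^ (2 * n - 3) + joint_error n p"
proof -
  let ?P = "oriented_gnp n p" and ?q = "1 - p / 2"
  let ?\<C> = "{S. S \<subseteq> {..<n} \<and> 3 \<le> card S \<and> card S + 3 \<le> n}"
  let ?\<S> = "Sigma {Q. Q \<subseteq> {..<n} \<and> card Q \<in> {3, 4}} Pow"
  define M where "M = avoid (source_cuts n a s) \<union> avoid (target_cuts n s b) \<union> avoid (end_cuts n a b)"
  define C where "C = (\<Union>S\<in>?\<C>. avoid (cut_arcs n S))"
  define R where "R = (\<Union>(Q, D)\<in>?\<S>. avoid (star_arcs n Q D))"
  define I where "I = (\<Union>(v, w)\<in>{..<n} \<times> {..<n}. avoid (isolating_arcs n v w))"
  have "\<omega> \<in> M \<union> C \<union> R \<union> I" if \<omega>: "\<omega> \<in> set_pmf ?P" "\<omega> \<in> no_path a s \<inter> no_path s b" for \<omega>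
  proof -
    obtain S where S: "S \<in> separators n a s" "\<omega> \<in> avoid (cut_arcs n S)"
      using no_path_iff_avoid_cut'[OF \<omega>(1) abs(1)] \<omega>(2) by blast
    obtain T where T: "T \<in> separators n s b" "\<omega> \<in> avoid (cut_arcs n T)"
      using no_path_iff_avoid_cut'[OF \<omega>(1) abs(2)] \<omega>(2) by blast
    show ?thesis
    proof (cases "S \<in> ?\<C> \<or> T \<in> ?\<C>")
      case True
      then show ?thesis using S T by (auto simp: C_def)
    next
      case False
      then have "card S \<le> 2 \<or> n \<le> card S + 2" "card T \<le> 2 \<or> n \<le> card T + 2"
        using S(1) T(1) by (auto simp: separators_def)
      note cases = two_cuts_cases[OF set_pmf_oriented_gnp(2)[OF \<omega>(1)] abs S T this]
      have R: "\<omega> \<in> R" if "D \<subseteq> Q" "Q \<subseteq> {..<n}" "card Q \<in> {3, 4}"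
          "\<omega> \<in> avoid (star_arcs n Q D)" for Q D
        unfolding R_def by (rule UN_I[of "(Q, D)"]) (use that in simp_all)
      have I: "\<omega> \<in> I" if "v < n" "w < n" "\<omega> \<in> avoid (isolating_arcs n v w)" for v w
        unfolding I_def by (rule UN_I[of "(v, w)"]) (use that in simp_all)
      from cases show ?thesis
        unfolding M_def using R I by blast
    qed
  qed
  then have "measure ?P (no_path a s \<inter> no_path s b) \<le> (\<Sum>A\<leftarrow>[M, C, R, I]. measure ?P A)"
    using prob_le_sum[of "{0::nat, 1, 2, 3}" ?P "no_path a s \<inter> no_path s b"
        "\<lambda>i. [M, C, R, I] ! i"]
    by (auto simp: numeral_2_eq_2 numeral_3_eq_3)
  also have "\<dots> = measure ?P M + measure ?P C + measure ?P R + measure ?P I" by simp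
  also have "measure ?P M \<le> 3 * ?q ^ (2 * n - 3)"
  proof -
    have "measure ?P M \<le> measure ?P (avoid (source_cuts n a s)) +
        measure ?P (avoid (target_cuts n s b)) + measure ?P (avoid (end_cuts n a b))"
      unfolding M_def
      by (intro order_trans[OF measure_Un_le] add_right_mono measure_Un_le) auto
    also have "\<dots> = 3 * ?q ^ (2 * n - 3)"
      using abs by (simp add: prob_avoid_one_way[OF p] one_way_source_cuts
          one_way_target_cuts one_way_end_cuts)
    finally show ?thesis .
  qed
  also have "measure ?P C \<le> cut_sum 3 n ?q"
  proof -
    have "measure ?P C \<le> (\<Sum>S\<in>?\<C>. measure ?P (avoid (cut_arcs n S)))"
      by (rule prob_le_sum) (auto simp: C_def)
    also have "\<dots> = cut_sum 3 n ?q"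
      unfolding cut_sum_def
      by (intro sum.cong refl) (auto simp: prob_avoid_one_way[OF p] one_way_cut_arcs card_cut_arcs)
    finally show ?thesis .
  qed
  also have "measure ?P R \<le> 32 * real n ^ 4 * ?q ^ (3 * (n - 3))"
  proof -
    have "finite ?\<S>"
      by (intro finite_SigmaI finite_cuts) (auto intro: finite_subset)
    then have "measure ?P R \<le> (\<Sum>x\<in>?\<S>. measure ?P (avoid (star_arcs n (fst x) (snd x))))"
      by (rule prob_le_sum) (force simp: R_def)
    then show ?thesis using sum_star_arcs_le[OF p n] by (simp add: case_prod_beta)
  qed
  also have "measure ?P I \<le> (real n)\<^sup>2 * (1 - p) ^ (n - 2)"
  proof -
    have "measure ?P I \<le> (\<Sum>x\<in>{..<n} \<times> {..<n}. measure ?P (avoid (isolating_arcs n (fst x) (snd x))))"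
      by (rule prob_le_sum) (force simp: I_def)+
    also have "\<dots> \<le> (\<Sum>x\<in>{..<n} \<times> {..<n}. (1 - p) ^ (n - 2))"
      by (intro sum_mono prob_avoid_isolating_arcs[OF p]) auto
    finally show ?thesis by (simp add: power2_eq_square)
  qed
  finally show ?thesis
    using cut_sum_nonneg[of ?q 3 n] p by (simp add: joint_error_def)
qed

text \<open>Any two of the main configurations together avoid a star set around \<open>{a, s, b}\<close>, so by inclusion
  and exclusion their union has almost the sum of their probabilities.\<close>

lemma prob_no_path_both_ge:
  assumes p: "p \<in> {0..1}" and n: "3 \<le> n"
    and abs: "a < n" "s < n" "b < n" "distinct [a, s, b]"
  shows "3 * (1 - p / 2) ^ (2 * n - 3) - 3 * (1 - p / 2) ^ (3 * (n - 3)) \<le>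
    measure (oriented_gnp n p) (no_path a s \<inter> no_path s b)"
proof -
  let ?P = "oriented_gnp n p" and ?q = "1 - p / 2"
  define M1 where "M1 = avoid (source_cuts n a s)"
  define M2 where "M2 = avoid (target_cuts n s b)"
  define M3 where "M3 = avoid (end_cuts n a b)"
  have sep: "{a} \<in> separators n a s" "{a, s} \<in> separators n s b"
      "{..<n} - {s, b} \<in> separators n a s" "{..<n} - {b} \<in> separators n s b"
    using abs by (auto simp: separators_def)
  have sub: "\<omega> \<in> no_path a s \<inter> no_path s b"
    if "\<omega> \<in> set_pmf ?P" "\<omega> \<in> (M1 \<union> M2) \<union> M3" for \<omega>
    using no_path_iff_avoid_cut'[OF that(1) abs(1)] no_path_iff_avoid_cut'[OF that(1) abs(2)] that(2) sep
    unfolding M1_def M2_def M3_def source_cuts_def target_cuts_def avoid_Un by blast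
  have card3: "card {a, s, b} = 3" using abs(4) by simp
  have small: "measure ?P (avoid F \<inter> avoid G) \<le> ?q ^ (3 * (n - 3))"
    if "star_arcs n {a, s, b} D \<subseteq> F \<union> G" "D \<subseteq> {a, s, b}" for F G D
  proof -
    have "measure ?P (avoid F \<inter> avoid G) \<le> measure ?P (avoid (star_arcs n {a, s, b} D))"
      using avoid_antimono[OF that(1)] unfolding avoid_Un
      by (intro measure_pmf.finite_measure_mono) auto
    also have "\<dots> = ?q ^ (3 * (n - 3))"
      using prob_avoid_star_arcs[OF p that(2), of n] abs(1-3) card3 by simp
    finally show ?thesis .
  qed
  have pairs: "measure ?P (M1 \<inter> M2) \<le> ?q ^ (3 * (n - 3))"
      "measure ?P (M1 \<inter> M3) \<le> ?q ^ (3 * (n - 3))" "measure ?P (M2 \<inter> M3) \<le> ?q ^ (3 * (n - 3))"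
    unfolding M1_def M2_def M3_def
    by (rule small[where D = "{a, s}"] small[where D = "{a}"];
        use abs in \<open>auto simp: star_arcs_def source_cuts_def target_cuts_def cut_arcs_def\<close>)+
  have "measure ?P (M1 \<union> M2) + measure ?P M3 - measure ?P ((M1 \<union> M2) \<inter> M3) \<le>
      measure ?P (no_path a s \<inter> no_path s b)"
    by (rule prob_ge_two) (rule sub)
  moreover have "measure ?P M1 + measure ?P M2 - measure ?P (M1 \<inter> M2) \<le> measure ?P (M1 \<union> M2)"
    by (rule prob_ge_two)
  moreover have "measure ?P ((M1 \<union> M2) \<inter> M3) \<le> measure ?P (M1 \<inter> M3) + measure ?P (M2 \<inter> M3)"
    unfolding Int_Un_distrib2 by (rule measure_Un_le) auto
  moreover have "measure ?P M1 = ?q ^ (2 * n - 3)" "measure ?P M2 = ?q ^ (2 * n - 3)"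
      "measure ?P M3 = ?q ^ (2 * n - 3)"
    using abs by (simp_all add: M1_def M2_def M3_def prob_avoid_one_way[OF p] one_way_source_cuts
          one_way_target_cuts one_way_end_cuts)
  ultimately show ?thesis using pairs by linarith
qed

section \<open>The errors are negligible\<close>

lemma power_times_geometric_tendsto_0:
  fixes x :: real
  assumes "0 < x" "x < 1"
  shows "(\<lambda>n. real n ^ k * x ^ n) \<longlonglongrightarrow> 0"
proof (cases "k = 0")
  case True
  then show ?thesis using assms by (simp add: LIMSEQ_power_zero)
next
  case False
  define y where "y = root k x"
  have y: "0 < y" "y < 1" "y ^ k = x"
    using assms False by (auto simp: y_def)
  have "(\<lambda>n. (real n * y ^ n) ^ k) \<longlonglongrightarrow> 0 ^ k"
    by (intro tendsto_power powser_times_n_limit_0) (use y in auto)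
  moreover have "(real n * y ^ n) ^ k = real n ^ k * x ^ n" for n
    unfolding y(3)[symmetric] by (simp add: power_mult_distrib mult.commute flip: power_mult)
  ultimately show ?thesis using False by (simp add: power_0_left)
qed

lemma poly_over_power_tendsto_0:
  fixes x q :: real
  assumes "0 < x" "x < q\<^sup>2"
  shows "(\<lambda>n. C * real n ^ k * x ^ n / q ^ (2 * n)) \<longlonglongrightarrow> 0"
proof -
  have "0 < q\<^sup>2" using assms by linarith
  then have "0 < x / q\<^sup>2" "x / q\<^sup>2 < 1" using assms by simp_all
  then have "(\<lambda>n. C * (real n ^ k * (x / q\<^sup>2) ^ n)) \<longlonglongrightarrow> C * 0"
    by (intro tendsto_intros power_times_geometric_tendsto_0)
  then show ?thesis by (simp add: power_divide power_mult mult.assoc)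
qed

text \<open>The exponent \<open>j (n - j)\<close> is written as \<open>j n - j j\<close> here, to compare with powers of the form
  \<open>y ^ n\<close>.\<close>

lemma eventually_cut_sum_le:
  assumes x: "0 < x" "x < 1"
  shows "\<forall>\<^sub>F n in sequentially. cut_sum j n x \<le> 2 / x ^ (j * j) * real n ^ Suc j * (x ^ j) ^ n"
proof -
  have h: "(\<lambda>m. 2 * (real m ^ 1 * x ^ m) + real (2 * j + 1) * (real m ^ 0 * x ^ m)) \<longlonglongrightarrow>
      2 * 0 + real (2 * j + 1) * 0"
    by (intro tendsto_intros power_times_geometric_tendsto_0 x)
  have "filterlim (\<lambda>n::nat. (n - 2 * j) div 2) at_top sequentially"
  proof (rule filterlim_at_top[THEN iffD2], intro allI)
    fix Z :: nat
    show "\<forall>\<^sub>F n in sequentially. Z \<le> (n - 2 * j) div 2"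
      using eventually_ge_at_top[of "2 * Z + 2 * j"] by eventually_elim linarith
  qed
  from filterlim_compose[OF h this]
  have "\<forall>\<^sub>F n in sequentially. 2 * (real ((n - 2 * j) div 2) ^ 1 * x ^ ((n - 2 * j) div 2)) +
      real (2 * j + 1) * (real ((n - 2 * j) div 2) ^ 0 * x ^ ((n - 2 * j) div 2)) < 1"
    by (rule order_tendstoD) simp
  then show ?thesis
    using eventually_ge_at_top[of "2 * j + 1"]
  proof eventually_elim
    case (elim n)
    let ?m = "(n - 2 * j) div 2"
    have "n \<le> 2 * ?m + (2 * j + 1)" using elim(2) by linarith
    then have "real n \<le> real (2 * ?m + (2 * j + 1))" by (simp only: of_nat_le_iff)
    then have "real n * x ^ ?m \<le> real (2 * ?m + (2 * j + 1)) * x ^ ?m"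
      using x by (intro mult_right_mono) auto
    also have "\<dots> = 2 * (real ?m ^ 1 * x ^ ?m) + real (2 * j + 1) * (real ?m ^ 0 * x ^ ?m)"
      by (simp add: algebra_simps)
    also note elim(1)
    finally have "cut_sum j n x \<le> real (n + 1) * real n ^ j * x ^ (j * (n - j))"
      using x by (intro cut_sum_le) auto
    also have "\<dots> \<le> (2 * real n) * real n ^ j * x ^ (j * (n - j))"
      using x elim(2) by (intro mult_right_mono) auto
    also have "x ^ (j * (n - j)) = (x ^ j) ^ n / x ^ (j * j)"
      using elim(2) x by (simp add: power_mult[symmetric] diff_mult_distrib2 power_diff mult_le_mono2)
    finally show ?case by (simp add: mult_ac)
  qed
qed

text \<open>The bound of \<open>product_moment_no_path_approx\<close>. It also bounds the error in the square of
  \<open>\<P>(\<not> u \<rightarrow> v)\<close>, because \<open>q \<le> rate p\<close>.\<close>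

definition moment_error :: "nat \<Rightarrow> real \<Rightarrow> real" where
  "moment_error n p = 4 * rate p ^ (n - 1) * cut_error n p + (cut_error n p)\<^sup>2"

lemma cut_error_nonneg: "p \<in> {0..1} \<Longrightarrow> 0 \<le> cut_error n p"
  using rate_pos[of p] cut_sum_nonneg[of "rate p" 2 n] by (simp add: cut_error_def)

lemma moment_error_negligible:
  assumes p: "0 < p" "p \<le> 1"
  shows "(\<lambda>n. moment_error n p / (1 - p / 2) ^ (2 * n)) \<longlonglongrightarrow> 0"
proof -
  let ?r = "rate p" and ?q = "1 - p / 2"
  have r: "0 < ?r" "?r < 1" using rate_pos[of p] rate_less_one[of p] p by auto
  define K where "K = 3 / ?r ^ 4"
  define L where "L = 4 * K / ?r + K\<^sup>2"
  have K: "0 < K" using r by (simp add: K_def)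
  have "\<forall>\<^sub>F n in sequentially. cut_error n p \<le> K * real n ^ 3 * ?r ^ (2 * n)"
    using eventually_cut_sum_le[OF r, of 2] eventually_ge_at_top[of 2]
  proof eventually_elim
    case (elim n)
    have "cut_sum 2 n ?r \<le> 2 / ?r ^ 4 * real n ^ 3 * ?r ^ (2 * n)"
      using elim(1) by (simp add: power_mult numeral_3_eq_3)
    moreover have "?r ^ (2 * n - 3) \<le> 1 / ?r ^ 4 * real n ^ 3 * ?r ^ (2 * n)"
    proof -
      have "?r ^ (2 * n - 3) \<le> ?r ^ (2 * n - 4)" using r by (intro power_decreasing) auto
      also have "\<dots> = 1 * (?r ^ (2 * n) / ?r ^ 4)" using r elim(2) by (simp add: power_diff)
      also have "\<dots> \<le> real n ^ 3 * (?r ^ (2 * n) / ?r ^ 4)"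
        using r elim(2) by (intro mult_right_mono one_le_power) auto
      finally show ?thesis by (simp add: mult_ac)
    qed
    ultimately have "cut_error n p \<le>
        2 / ?r ^ 4 * real n ^ 3 * ?r ^ (2 * n) + 1 / ?r ^ 4 * real n ^ 3 * ?r ^ (2 * n)"
      by (simp add: cut_error_def)
    then show ?case by (simp add: K_def field_simps)
  qed
  then have "\<forall>\<^sub>F n in sequentially. moment_error n p \<le> L * real n ^ 6 * (?r ^ 3) ^ n"
    using eventually_ge_at_top[of 1]
  proof eventually_elim
    case (elim n)
    have n: "1 \<le> real n" using elim(2) by simp
    have "4 * ?r ^ (n - 1) * cut_error n p \<le> 4 * ?r ^ (n - 1) * (K * real n ^ 3 * ?r ^ (2 * n))"
      using elim(1) r by (intro mult_left_mono) auto
    also have "\<dots> = 4 * K / ?r * real n ^ 3 * (?r ^ 3) ^ n"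
    proof -
      have "?r ^ (n - 1) = ?r ^ n / ?r" using r elim(2) by (simp add: power_diff)
      moreover have "(?r ^ 3) ^ n = ?r ^ n * ?r ^ (2 * n)" by (simp flip: power_mult power_add)
      ultimately show ?thesis by simp
    qed
    also have "\<dots> \<le> 4 * K / ?r * real n ^ 6 * (?r ^ 3) ^ n"
      using n K r by (intro mult_right_mono mult_left_mono power_increasing) auto
    finally have 1: "4 * ?r ^ (n - 1) * cut_error n p \<le> 4 * K / ?r * real n ^ 6 * (?r ^ 3) ^ n" .
    have "(cut_error n p)\<^sup>2 \<le> (K * real n ^ 3 * ?r ^ (2 * n))\<^sup>2"
      using elim(1) cut_error_nonneg[of p n] p by (intro power_mono) auto
    also have "\<dots> = K\<^sup>2 * real n ^ 6 * ?r ^ (4 * n)"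
      by (simp add: power_mult_distrib flip: power_mult)
    also have "\<dots> \<le> K\<^sup>2 * real n ^ 6 * ?r ^ (3 * n)"
      using r by (intro mult_left_mono power_decreasing) auto
    finally have 2: "(cut_error n p)\<^sup>2 \<le> K\<^sup>2 * real n ^ 6 * (?r ^ 3) ^ n"
      by (simp add: power_mult)
    show ?case using 1 2 by (simp add: moment_error_def L_def distrib_right)
  qed
  then have "\<forall>\<^sub>F n in sequentially. norm (moment_error n p / ?q ^ (2 * n)) \<le>
      L * real n ^ 6 * (?r ^ 3) ^ n / ?q ^ (2 * n)"
  proof eventually_elim
    case (elim n)
    have "0 \<le> moment_error n p"
      using cut_error_nonneg[of p n] p r by (simp add: moment_error_def)
    then show ?case using elim p by (simp add: divide_right_mono)
  qed
  moreover have "(\<lambda>n. L * real n ^ 6 * (?r ^ 3) ^ n / ?q ^ (2 * n)) \<longlonglongrightarrow> 0"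
    using rate_cube_less[OF p] r by (intro poly_over_power_tendsto_0) auto
  ultimately show ?thesis by (rule Lim_null_comparison)
qed

lemma joint_error_negligible:
  assumes p: "0 < p" "p \<le> 1"
  shows "(\<lambda>n. joint_error n p / (1 - p / 2) ^ (2 * n)) \<longlonglongrightarrow> 0"
proof -
  let ?q = "1 - p / 2"
  have q: "0 < ?q" "?q < 1" using p by auto
  have "?q ^ 3 < ?q\<^sup>2" using q by (intro power_strict_decreasing) auto
  \<comment> \<open>A positive number in place of \<open>1 - p\<close>, which is \<open>0\<close> for \<open>p = 1\<close>.\<close>
  define y where "y = (1 - p + ?q\<^sup>2) / 2"
  have "1 - p < ?q\<^sup>2" using p by (simp add: power2_eq_square algebra_simps)
  then have y: "1 - p \<le> y" "y < ?q\<^sup>2" "0 < y" using p by (auto simp: y_def)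
  define K where "K = 36 / ?q ^ 9"
  have "\<forall>\<^sub>F n in sequentially. joint_error n p \<le>
      K * real n ^ 4 * (?q ^ 3) ^ n + 1 / y\<^sup>2 * real n ^ 2 * y ^ n"
    using eventually_cut_sum_le[OF q, of 3] eventually_ge_at_top[of 3]
  proof eventually_elim
    case (elim n)
    have "2 * cut_sum 3 n ?q \<le> 2 * (2 / ?q ^ 9 * real n ^ 4 * (?q ^ 3) ^ n)"
      using elim(1) by (simp add: eval_nat_numeral)
    moreover have "?q ^ (3 * (n - 3)) = (?q ^ 3) ^ n / ?q ^ 9"
      using q elim(2) by (simp add: diff_mult_distrib2 power_diff flip: power_mult)
    moreover have "(real n)\<^sup>2 * (1 - p) ^ (n - 2) \<le> (real n)\<^sup>2 * (y ^ n / y\<^sup>2)"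
    proof -
      have "(1 - p) ^ (n - 2) \<le> y ^ (n - 2)" using y p by (intro power_mono) auto
      also have "\<dots> = y ^ n / y\<^sup>2" using y elim(2) by (simp add: power_diff)
      finally show ?thesis by (intro mult_left_mono) auto
    qed
    ultimately have "joint_error n p \<le> 2 * (2 / ?q ^ 9 * real n ^ 4 * (?q ^ 3) ^ n) +
        32 * real n ^ 4 * ((?q ^ 3) ^ n / ?q ^ 9) + (real n)\<^sup>2 * (y ^ n / y\<^sup>2)"
      by (simp add: joint_error_def)
    also have "\<dots> = K * real n ^ 4 * (?q ^ 3) ^ n + 1 / y\<^sup>2 * real n ^ 2 * y ^ n"
      by (simp add: K_def add_divide_distrib[symmetric])
    finally show ?case .
  qed
  then have "\<forall>\<^sub>F n in sequentially. norm (joint_error n p / ?q ^ (2 * n)) \<le>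
      (K * real n ^ 4 * (?q ^ 3) ^ n + 1 / y\<^sup>2 * real n ^ 2 * y ^ n) / ?q ^ (2 * n)"
  proof eventually_elim
    case (elim n)
    have "0 \<le> joint_error n p"
      using cut_sum_nonneg[of ?q 3 n] p q by (simp add: joint_error_def)
    moreover have d: "0 < ?q ^ (2 * n)" by (rule zero_less_power[OF q(1)])
    ultimately have "norm (joint_error n p / ?q ^ (2 * n)) = joint_error n p / ?q ^ (2 * n)"
      by (simp only: real_norm_def abs_of_nonneg divide_nonneg_pos)
    then show ?case
      using divide_right_mono[OF elim less_imp_le[OF d]] by (simp only:)
  qed
  moreover have "(\<lambda>n. K * real n ^ 4 * (?q ^ 3) ^ n / ?q ^ (2 * n) +
      1 / y\<^sup>2 * real n ^ 2 * y ^ n / ?q ^ (2 * n)) \<longlonglongrightarrow> 0 + 0"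
    by (intro tendsto_add poly_over_power_tendsto_0)
      (use q y \<open>?q ^ 3 < ?q\<^sup>2\<close> in simp_all)
  then have "(\<lambda>n. (K * real n ^ 4 * (?q ^ 3) ^ n + 1 / y\<^sup>2 * real n ^ 2 * y ^ n) / ?q ^ (2 * n))
      \<longlonglongrightarrow> 0"
    unfolding add_divide_distrib by simp
  ultimately show ?thesis by (rule Lim_null_comparison)
qed

section \<open>The asymptotics\<close>

text \<open>The origin of the exponential: two random sets of \<open>n - 1\<close> among \<open>n (n - 1) / 2\<close> pairs have
  \<open>2 (n - 1) / n\<close> pairs in common on average.\<close>

lemma tendsto_hypergeom_gf_stars:
  assumes "p \<in> {0..1}"
  shows "(\<lambda>n. hypergeom_gf (n choose 2) (n - 1) (n - 1) (corr p)) \<longlonglongrightarrow> exp (2 * corr p)"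
proof (rule hypergeom_gf_tendsto_exp)
  show "0 \<le> corr p" by (rule corr_nonneg[OF assms])
  show top: "filterlim (\<lambda>n::nat. n - 1) at_top sequentially"
    by (rule filterlim_minus_const_nat_at_top)
  show le: "n - 1 \<le> n choose 2" for n :: nat
  proof (cases "n \<le> 1")
    case False
    then have "2 * (n - 1) \<le> n * (n - 1)" by (intro mult_right_mono) auto
    then have "2 * (n - 1) div 2 \<le> n * (n - 1) div 2" by (rule div_le_mono)
    then show ?thesis by (simp add: choose_two)
  qed auto
  show "filterlim (\<lambda>n. n choose 2) at_top sequentially"
    by (rule filterlim_at_top_mono[OF top always_eventually]) (rule allI, rule le)
  have "(\<lambda>n. 2 - 2 / real n) \<longlonglongrightarrow> 2 - 0"
    by (intro tendsto_diff tendsto_const lim_const_over_n)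
  moreover have "\<forall>\<^sub>F n in sequentially. 2 - 2 / real n = (real (n - 1))\<^sup>2 / real (n choose 2)"
    using eventually_ge_at_top[of 2]
  proof eventually_elim
    case (elim n)
    define x where "x = real n - 1"
    have x: "x \<noteq> 0" "real n = x + 1" using elim by (simp_all add: x_def)
    have "real (n choose 2) = real n * x / 2" "real (n - 1) = x"
      using elim by (simp_all add: choose_two real_of_nat_div of_nat_diff x_def)
    then have "(real (n - 1))\<^sup>2 / real (n choose 2) = x\<^sup>2 / (real n * x / 2)"
      by (simp only:)
    also have "\<dots> = 2 * x / real n" using x(1) by (simp add: power2_eq_square)
    also have "\<dots> = 2 - 2 / real n" using elim by (simp add: x_def field_simps)
    finally show ?case by (rule sym)
  qed
  ultimately show "(\<lambda>n. (real (n - 1))\<^sup>2 / real (n choose 2)) \<longlonglongrightarrow> 2"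
    by (simp add: Lim_transform_eventually)
qed

lemma variance_prob_given_approx:
  assumes p: "p \<in> {0..1}" and n: "3 \<le> n" and uv: "u < n" "v < n" "u \<noteq> v"
  shows "\<bar>measure_pmf.variance (oriented_gnp n p)
      (prob_given (oriented_gnp n p) (no_path u v) num_edges) -
      4 * (1 - p / 2) ^ (2 * n - 2) * (hypergeom_gf (n choose 2) (n - 1) (n - 1) (corr p) - 1)\<bar>
    \<le> 2 * moment_error n p"
proof -
  let ?P = "oriented_gnp n p" and ?q = "1 - p / 2"
  let ?X = "prob_given ?P (no_path u v) num_edges"
  define m where "m = measure ?P (no_path u v)"
  define x where "x = ?q ^ (n - 1)"
  define h where "h = hypergeom_gf (n choose 2) (n - 1) (n - 1) (corr p)"
  have q: "0 \<le> ?q" "?q \<le> rate p" using p one_minus_half_le_rate[OF p] by auto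
  have var: "measure_pmf.variance ?P ?X = measure_pmf.expectation ?P (\<lambda>\<omega>. ?X \<omega> * ?X \<omega>) - m\<^sup>2"
    by (subst measure_pmf.variance_eq)
      (simp_all add: expectation_prob_given[OF finite_set_pmf_oriented_gnp] m_def power2_eq_square)
  have xx: "?q ^ (2 * n - 2) = x * x"
  proof -
    have "2 * n - 2 = (n - 1) + (n - 1)" by simp
    then show ?thesis unfolding x_def by (simp only: power_add)
  qed
  have second: "\<bar>measure_pmf.expectation ?P (\<lambda>\<omega>. ?X \<omega> * ?X \<omega>) - 4 * (x * x * h)\<bar> \<le> moment_error n p"
    using product_moment_no_path_approx[OF p n uv uv]
    by (simp add: moment_error_def pair_moment_def h_def x_def power_add)
  have d: "\<bar>m - 2 * x\<bar> \<le> cut_error n p"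
    unfolding m_def x_def by (rule prob_no_path_approx[OF p n uv])
  have "\<bar>m\<^sup>2 - 4 * (x * x)\<bar> = \<bar>(m - 2 * x)\<^sup>2 + 4 * x * (m - 2 * x)\<bar>"
    by (simp add: power2_eq_square algebra_simps)
  also have "\<dots> \<le> \<bar>m - 2 * x\<bar>\<^sup>2 + 4 * x * \<bar>m - 2 * x\<bar>"
    using q by (intro order_trans[OF abs_triangle_ineq]) (simp add: abs_mult x_def)
  also have "\<dots> \<le> (cut_error n p)\<^sup>2 + 4 * rate p ^ (n - 1) * cut_error n p"
    using d q by (intro add_mono power_mono mult_mono) (auto simp: x_def power_mono)
  finally have first: "\<bar>m\<^sup>2 - 4 * (x * x)\<bar> \<le> moment_error n p"
    by (simp add: moment_error_def)
  have "measure_pmf.variance ?P ?X - 4 * ?q ^ (2 * n - 2) * (h - 1) =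
      (measure_pmf.expectation ?P (\<lambda>\<omega>. ?X \<omega> * ?X \<omega>) - 4 * (x * x * h)) - (m\<^sup>2 - 4 * (x * x))"
    unfolding var xx by (simp add: algebra_simps)
  then show ?thesis using first second unfolding h_def by linarith
qed

text \<open>The main term of the product has exponent \<open>2 n - 2\<close>, one more than the joint probability; the
  spare factor \<open>q\<close> turns its coefficient \<open>4\<close> into \<open>4 - 2 p\<close>.\<close>

lemma expectation_cov_given_approx:
  assumes p: "p \<in> {0..1}" and n: "7 \<le> n"
    and abs: "a < n" "s < n" "b < n" "distinct [a, s, b]"
  shows "\<bar>measure_pmf.expectation (oriented_gnp n p)
      (cov_given (oriented_gnp n p) (no_path a s) (no_path s b) num_edges) -
      (1 - p / 2) ^ (2 * n - 3) *
        (3 - (4 - 2 * p) * hypergeom_gf (n choose 2) (n - 1) (n - 1) (corr p))\<bar>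
    \<le> joint_error n p + moment_error n p"
proof -
  let ?P = "oriented_gnp n p" and ?q = "1 - p / 2"
  let ?X = "prob_given ?P (no_path a s) num_edges"
  let ?Y = "prob_given ?P (no_path s b) num_edges"
  define m where "m = measure ?P (no_path a s \<inter> no_path s b)"
  define e where "e = measure_pmf.expectation ?P (\<lambda>\<omega>. ?X \<omega> * ?Y \<omega>)"
  define x where "x = ?q ^ (2 * n - 3)"
  define h where "h = hypergeom_gf (n choose 2) (n - 1) (n - 1) (corr p)"
  have q: "0 \<le> ?q" using p by auto
  have cov: "measure_pmf.expectation ?P (cov_given ?P (no_path a s) (no_path s b) num_edges) = m - e"
    unfolding cov_given_def
    by (simp add: expectation_prob_given[OF finite_set_pmf_oriented_gnp] m_def e_def)
  have "3 * ?q ^ (3 * (n - 3)) \<le> joint_error n p"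
  proof -
    have "3 \<le> 32 * real n ^ 4"
      using n one_le_power[of "real n" 4] by linarith
    then have "3 * ?q ^ (3 * (n - 3)) \<le> 32 * real n ^ 4 * ?q ^ (3 * (n - 3))"
      using q by (intro mult_right_mono zero_le_power)
    moreover have "0 \<le> (real n)\<^sup>2 * (1 - p) ^ (n - 2)" using p by simp
    ultimately show ?thesis
      using cut_sum_nonneg[OF q, of 3 n] unfolding joint_error_def by linarith
  qed
  then have m: "\<bar>m - 3 * x\<bar> \<le> joint_error n p"
    using prob_no_path_both_le[OF p n abs] prob_no_path_both_ge[OF p _ abs] n
    by (simp add: m_def x_def abs_le_iff)
  have "(n - 1) + (n - 1) = Suc (2 * n - 3)" using n by simp
  then have "4 * pair_moment n p (n - 1) (n - 1) = (4 - 2 * p) * x * h"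
    unfolding pair_moment_def x_def h_def by (simp add: algebra_simps)
  then have e: "\<bar>e - (4 - 2 * p) * x * h\<bar> \<le> moment_error n p"
    using product_moment_no_path_approx[OF p _ abs(1,2) _ abs(2,3)] abs(4) n
    by (simp add: e_def moment_error_def)
  have "m - e - x * (3 - (4 - 2 * p) * h) = (m - 3 * x) - (e - (4 - 2 * p) * x * h)"
    by (simp add: algebra_simps)
  then show ?thesis using m e unfolding cov x_def[symmetric] h_def[symmetric] by linarith
qed

text \<open>An error that is small compared to \<open>q ^ (2 n)\<close> is small compared to \<open>q ^ (2 n - j)\<close>. The bounds
  \<open>7 \<le> n\<close> and \<open>j \<le> 7\<close> keep the subtraction in the exponent from being cut off at \<open>0\<close>.\<close>

lemma normalised_error_tendsto:
  fixes q :: real and f g h :: "nat \<Rightarrow> real"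
  assumes q: "0 < q" and h: "h \<longlonglongrightarrow> l" and g: "(\<lambda>n. g n / q ^ (2 * n)) \<longlonglongrightarrow> 0"
    and bound: "\<And>n. 7 \<le> n \<Longrightarrow> \<bar>f n - q ^ (2 * n - j) * h n\<bar> \<le> g n" and "j \<le> 7"
  shows "(\<lambda>n. f n / q ^ (2 * n - j)) \<longlonglongrightarrow> l"
proof -
  have "\<forall>\<^sub>F n in sequentially. norm (f n / q ^ (2 * n - j) - h n) \<le> q ^ j * (g n / q ^ (2 * n))"
    using eventually_ge_at_top[of 7]
  proof eventually_elim
    case (elim n)
    have "f n / q ^ (2 * n - j) - h n = (f n - q ^ (2 * n - j) * h n) / q ^ (2 * n - j)"
      using q by (simp add: field_simps)
    then have "norm (f n / q ^ (2 * n - j) - h n) \<le> g n / q ^ (2 * n - j)"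
      using bound[OF elim] q by (simp add: divide_right_mono)
    also have "\<dots> = q ^ j * (g n / q ^ (2 * n))"
      using q elim \<open>j \<le> 7\<close> by (simp add: power_diff)
    finally show ?case .
  qed
  moreover have "(\<lambda>n. q ^ j * (g n / q ^ (2 * n))) \<longlonglongrightarrow> 0"
    using tendsto_mult_left[OF g, of "q ^ j"] by simp
  ultimately have "(\<lambda>n. f n / q ^ (2 * n - j) - h n) \<longlonglongrightarrow> 0"
    by (rule Lim_null_comparison)
  from tendsto_add[OF this h] show ?thesis by simp
qed

theorem theorem8p2:
  fixes p :: real and a s b :: "nat \<Rightarrow> nat"
  assumes "0 < p" and "p \<le> 1"
    and "\<And>n. n \<ge> 3 \<Longrightarrow> a n < n \<and> s n < n \<and> b n < n"
    and "\<And>n. n \<ge> 3 \<Longrightarrow> distinct [a n, s n, b n]"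
  defines "A \<equiv> \<lambda>n. no_path (a n) (s n)"
    and "B \<equiv> \<lambda>n. no_path (s n) (b n)"
  shows "(\<exists>\<epsilon> :: nat \<Rightarrow> real. \<epsilon> \<longlonglongrightarrow> 0 \<and> (\<forall>n\<ge>3.
            measure_pmf.expectation (oriented_gnp n p)
              (cov_given (oriented_gnp n p) (A n) (B n) num_edges)
            = (3 - (4 - 2 * p) * exp (2 * (p * (1 - p) / (2 - p)\<^sup>2)) + \<epsilon> n)
              * (1 - p / 2) ^ (2 * n - 3)))
       \<and> (\<exists>\<epsilon> :: nat \<Rightarrow> real. \<epsilon> \<longlonglongrightarrow> 0 \<and> (\<forall>n\<ge>3.
            measure_pmf.variance (oriented_gnp n p)
              (prob_given (oriented_gnp n p) (A n) num_edges)
            = 4 * (exp (2 * (p * (1 - p) / (2 - p)\<^sup>2)) - 1 + \<epsilon> n)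
              * (1 - p / 2) ^ (2 * n - 2)))"
proof -
  let ?q = "1 - p / 2"
  define h where "h n = hypergeom_gf (n choose 2) (n - 1) (n - 1) (corr p)" for n
  define C where "C n = measure_pmf.expectation (oriented_gnp n p)
      (cov_given (oriented_gnp n p) (A n) (B n) num_edges)" for n
  define V where "V n = measure_pmf.variance (oriented_gnp n p)
      (prob_given (oriented_gnp n p) (A n) num_edges)" for n
  have p: "p \<in> {0..1}" and q: "0 < ?q" using assms(1,2) by auto
  have h: "h \<longlonglongrightarrow> exp (2 * corr p)"
    unfolding h_def by (rule tendsto_hypergeom_gf_stars[OF p])
  note negl = moment_error_negligible[OF assms(1,2)] joint_error_negligible[OF assms(1,2)]
  have C: "(\<lambda>n. C n / ?q ^ (2 * n - 3)) \<longlonglongrightarrow> 3 - (4 - 2 * p) * exp (2 * corr p)"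
  proof (rule normalised_error_tendsto[OF q])
    show "(\<lambda>n. 3 - (4 - 2 * p) * h n) \<longlonglongrightarrow> 3 - (4 - 2 * p) * exp (2 * corr p)"
      by (intro tendsto_intros h)
    show "(\<lambda>n. (joint_error n p + moment_error n p) / ?q ^ (2 * n)) \<longlonglongrightarrow> 0"
      using tendsto_add[OF negl(2,1)] by (simp add: add_divide_distrib)
    show "\<bar>C n - ?q ^ (2 * n - 3) * (3 - (4 - 2 * p) * h n)\<bar> \<le> joint_error n p + moment_error n p"
      if "7 \<le> n" for n
      unfolding C_def h_def A_def B_def
      using assms(3,4)[of n] that by (intro expectation_cov_given_approx p) auto
  qed simp
  have V: "(\<lambda>n. V n / ?q ^ (2 * n - 2)) \<longlonglongrightarrow> 4 * (exp (2 * corr p) - 1)"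
  proof (rule normalised_error_tendsto[OF q])
    show "(\<lambda>n. 4 * (h n - 1)) \<longlonglongrightarrow> 4 * (exp (2 * corr p) - 1)"
      by (intro tendsto_intros h)
    show "(\<lambda>n. 2 * moment_error n p / ?q ^ (2 * n)) \<longlonglongrightarrow> 0"
      using tendsto_mult_left[OF negl(1), of 2] by simp
    show "\<bar>V n - ?q ^ (2 * n - 2) * (4 * (h n - 1))\<bar> \<le> 2 * moment_error n p" if "7 \<le> n" for n
      using variance_prob_given_approx[OF p, of n "a n" "s n"] assms(3,4)[of n] that
      by (simp add: V_def h_def A_def mult_ac right_diff_distrib)
  qed simp
  have "\<exists>\<epsilon>. \<epsilon> \<longlonglongrightarrow> 0 \<and> (\<forall>n\<ge>3. C n =
      (3 - (4 - 2 * p) * exp (2 * corr p) + \<epsilon> n) * ?q ^ (2 * n - 3))"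
    by (rule exI[of _ "\<lambda>n. C n / ?q ^ (2 * n - 3) - (3 - (4 - 2 * p) * exp (2 * corr p))"])
      (use q LIM_zero[OF C] in simp)
  moreover have "\<exists>\<epsilon>. \<epsilon> \<longlonglongrightarrow> 0 \<and> (\<forall>n\<ge>3. V n =
      4 * (exp (2 * corr p) - 1 + \<epsilon> n) * ?q ^ (2 * n - 2))"
  proof (rule exI[of _ "\<lambda>n. (V n / ?q ^ (2 * n - 2)) / 4 - (exp (2 * corr p) - 1)"], intro conjI)
    have "(\<lambda>n. (V n / ?q ^ (2 * n - 2)) / 4) \<longlonglongrightarrow> 4 * (exp (2 * corr p) - 1) / 4"
      by (rule tendsto_divide[OF V tendsto_const]) simp
    then have "(\<lambda>n. (V n / ?q ^ (2 * n - 2)) / 4) \<longlonglongrightarrow> exp (2 * corr p) - 1"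
      by (simp only: nonzero_mult_div_cancel_left zero_neq_numeral[symmetric] not_False_eq_True)
    then show "(\<lambda>n. (V n / ?q ^ (2 * n - 2)) / 4 - (exp (2 * corr p) - 1)) \<longlonglongrightarrow> 0"
      by (rule LIM_zero)
  qed (use q in simp)
  ultimately show ?thesis
    unfolding C_def V_def corr_def by blast
qed

end
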